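(* Let $\Gamma$ be a Gromov hyperbolic group. Assume that $\Gamma$ is non-elementary and acts faithfully and spherically transitively on a rooted tree $\mathcal T$. Then $\bigcup_{v\in\mathcal T^0}\mathrm{Stab}_\Gamma(v\mathcal T)$ is finite.
   Context: Rooted tree: given a sequence $\bar d=d_0,d_1,\dots$ of integers $d_i\geq 2$, the rooted tree $\mathcal T=\mathcal T_{\bar d}$ is the infinite locally finite tree with a distinguished vertex $\varnothing$ (the root) of degree $d_0$ in which every vertex at distance $n\geq1$ from the root has degree $d_n+1$. $\mathcal T^0$ is its set of vertices and the $n$-th level $L_n$ is the set of vertices at distance $n$ from the root. For $v\in\mathcal T^0$, the subtree $v\mathcal T$ is the connected subgraph whose vertices are the descendants of $v$, i.e. the vertices $w$ such that $v$ lies on the geodesic path from $\varnothing$ to $w$. An action of a group $\Gamma$ on $\mathcal T$ is an action by graph automorphisms fixing the root; it is spherically transitive if $\Gamma$ acts transitively on each level $L_n$. $\mathrm{Stab}_\Gamma(v\mathcal T):=\{g\in\Gamma\mid g(x)=x\ \text{for all vertices } x\in v\mathcal T\}$. *)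

theory Defs
  imports Complex_Main "HOL-Algebra.Algebra"
begin

section \<open>Simple graphs and rooted trees\<close>

text \<open>
  A simple graph is given by a vertex set \<open>V\<close> and a symmetric irreflexive adjacency relation \<open>E\<close>
  on \<open>V\<close>; neither set need be finite. Walks are nonempty lists of vertices.
\<close>

definition simple_graph :: "'v set \<Rightarrow> ('v \<times> 'v) set \<Rightarrow> bool" where
  "simple_graph V E \<longleftrightarrow> E \<subseteq> V \<times> V \<and> sym E \<and> irrefl E"

definition walk_betw :: "'v set \<Rightarrow> ('v \<times> 'v) set \<Rightarrow> 'v \<Rightarrow> 'v list \<Rightarrow> 'v \<Rightarrow> bool" where
  "walk_betw V E x p y \<longleftrightarrow>
     p \<noteq> [] \<and> set p \<subseteq> V \<and> hd p = x \<and> last p = y \<and> successively (\<lambda>u v. (u, v) \<in> E) p"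

text \<open>The distance is an arbitrary value if \<open>x\<close> and \<open>y\<close> lie in different components.\<close>

definition graph_dist :: "'v set \<Rightarrow> ('v \<times> 'v) set \<Rightarrow> 'v \<Rightarrow> 'v \<Rightarrow> nat" where
  "graph_dist V E x y = (LEAST n. \<exists>p. walk_betw V E x p y \<and> length p = Suc n)"

definition geodesic_betw :: "'v set \<Rightarrow> ('v \<times> 'v) set \<Rightarrow> 'v \<Rightarrow> 'v list \<Rightarrow> 'v \<Rightarrow> bool" where
  "geodesic_betw V E x p y \<longleftrightarrow> walk_betw V E x p y \<and> length p = Suc (graph_dist V E x y)"

definition connected_graph :: "'v set \<Rightarrow> ('v \<times> 'v) set \<Rightarrow> bool" where
  "connected_graph V E \<longleftrightarrow> V \<noteq> {} \<and> (\<forall>x\<in>V. \<forall>y\<in>V. \<exists>p. walk_betw V E x p y)"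

text \<open>A cycle is listed without repeating its first vertex at the end.\<close>

definition acyclic_graph :: "'v set \<Rightarrow> ('v \<times> 'v) set \<Rightarrow> bool" where
  "acyclic_graph V E \<longleftrightarrow>
     \<not> (\<exists>x y p. walk_betw V E x p y \<and> distinct p \<and> length p \<ge> 3 \<and> (y, x) \<in> E)"

definition tree_graph :: "'v set \<Rightarrow> ('v \<times> 'v) set \<Rightarrow> bool" where
  "tree_graph V E \<longleftrightarrow> simple_graph V E \<and> connected_graph V E \<and> acyclic_graph V E"

text \<open>
  As \<open>card\<close> is \<open>0\<close> on infinite sets, positivity of the prescribed degrees makes the tree
  locally finite.
\<close>

locale rooted_tree =
  fixes V :: "'v set" and E :: "('v \<times> 'v) set" and r :: 'v and d :: "nat \<Rightarrow> nat"
  assumes tree: "tree_graph V E"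
    and root_in_V: "r \<in> V"
    and d_ge_2: "\<And>i. d i \<ge> 2"
    and degree_root: "card (E `` {r}) = d 0"
    and degree: "\<And>n v. \<lbrakk>n \<ge> 1; v \<in> V; graph_dist V E r v = n\<rbrakk> \<Longrightarrow> card (E `` {v}) = d n + 1"

definition tree_level :: "'v set \<Rightarrow> ('v \<times> 'v) set \<Rightarrow> 'v \<Rightarrow> nat \<Rightarrow> 'v set" where
  "tree_level V E r n = {v \<in> V. graph_dist V E r v = n}"

definition descendants :: "'v set \<Rightarrow> ('v \<times> 'v) set \<Rightarrow> 'v \<Rightarrow> 'v \<Rightarrow> 'v set" where
  "descendants V E r v = {w \<in> V. \<exists>p. geodesic_betw V E r p w \<and> v \<in> set p}"


section \<open>Actions on rooted trees\<close>

locale rooted_tree_action = rooted_tree V E r d + group_action G V \<phi>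
  for V :: "'v set" and E r d and G :: "('g, 'b) monoid_scheme" (structure)
    and \<phi> :: "'g \<Rightarrow> 'v \<Rightarrow> 'v" +
  assumes adj_iff: "\<And>g x y. \<lbrakk>g \<in> carrier G; x \<in> V; y \<in> V\<rbrakk> \<Longrightarrow> (\<phi> g x, \<phi> g y) \<in> E \<longleftrightarrow> (x, y) \<in> E"
    and fixes_root: "\<And>g. g \<in> carrier G \<Longrightarrow> \<phi> g r = r"

definition spherically_transitive ::
    "('g, 'b) monoid_scheme \<Rightarrow> 'v set \<Rightarrow> ('v \<times> 'v) set \<Rightarrow> 'v \<Rightarrow> ('g \<Rightarrow> 'v \<Rightarrow> 'v) \<Rightarrow> bool" where
  "spherically_transitive G V E r \<phi> \<longleftrightarrow>
     (\<forall>n. \<forall>x\<in>tree_level V E r n. \<forall>y\<in>tree_level V E r n. \<exists>g\<in>carrier G. \<phi> g x = y)"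

definition subtree_stabilizer ::
    "('g, 'b) monoid_scheme \<Rightarrow> 'v set \<Rightarrow> ('v \<times> 'v) set \<Rightarrow> 'v \<Rightarrow> ('g \<Rightarrow> 'v \<Rightarrow> 'v) \<Rightarrow> 'v \<Rightarrow> 'g set" where
  "subtree_stabilizer G V E r \<phi> v = {g \<in> carrier G. \<forall>x\<in>descendants V E r v. \<phi> g x = x}"


section \<open>Hyperbolic groups\<close>

definition cayley_edges :: "('g, 'b) monoid_scheme \<Rightarrow> 'g set \<Rightarrow> ('g \<times> 'g) set" where
  "cayley_edges G S = {(g, h). g \<in> carrier G \<and> h \<in> carrier G \<and> g \<noteq> h \<and>
     (\<exists>s\<in>S. h = g \<otimes>\<^bsub>G\<^esub> s \<or> g = h \<otimes>\<^bsub>G\<^esub> s)}"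

definition word_metric :: "('g, 'b) monoid_scheme \<Rightarrow> 'g set \<Rightarrow> 'g \<Rightarrow> 'g \<Rightarrow> real" where
  "word_metric G S g h = real (graph_dist (carrier G) (cayley_edges G S) g h)"

definition Gromov_product :: "('a \<Rightarrow> 'a \<Rightarrow> real) \<Rightarrow> 'a \<Rightarrow> 'a \<Rightarrow> 'a \<Rightarrow> real" where
  "Gromov_product dst w x y = (dst x w + dst y w - dst x y) / 2"

definition Gromov_hyperbolic_on :: "'a set \<Rightarrow> ('a \<Rightarrow> 'a \<Rightarrow> real) \<Rightarrow> bool" where
  "Gromov_hyperbolic_on M dst \<longleftrightarrow> (\<exists>\<delta>\<ge>0. \<forall>w\<in>M. \<forall>x\<in>M. \<forall>y\<in>M. \<forall>z\<in>M.
     Gromov_product dst w x z \<ge> min (Gromov_product dst w x y) (Gromov_product dst w y z) - \<delta>)"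

text \<open>
  Hyperbolicity does not depend on the finite generating set, so requiring it for some such set
  is the same as requiring it for all of them (in a finitely generated group).
\<close>

definition hyperbolic_group :: "('g, 'b) monoid_scheme \<Rightarrow> bool" where
  "hyperbolic_group G \<longleftrightarrow> group G \<and>
     (\<exists>S. finite S \<and> S \<subseteq> carrier G \<and> generate G S = carrier G \<and>
          Gromov_hyperbolic_on (carrier G) (word_metric G S))"

text \<open>
  Elementary means virtually cyclic; this includes the finite groups, since the trivial
  subgroup is cyclic.
\<close>

definition elementary_group :: "('g, 'b) monoid_scheme \<Rightarrow> bool" where
  "elementary_group G \<longleftrightarrow>
     (\<exists>H. subgroup H G \<and> cyclic_group (G\<lparr>carrier := H\<rparr>) \<and> finite (rcosets\<^bsub>G\<^esub> H))"

end

theory Submission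
  imports Defs
begin

text \<open>
  For a vertex \<open>v\<close> of level \<open>n\<close> write \<open>H\<^sub>v\<close> for the stabilizer of the subtree below \<open>v\<close>, and let \<open>K\<close> be the
  subgroup fixing all vertices of level at most \<open>n\<close>. It has finite index and normalizes \<open>H\<^sub>v\<close>.

  Suppose that \<open>H\<^sub>v\<close> is infinite. By spherical transitivity all \<open>H\<^sub>w\<close> with \<open>w\<close> in the level of \<open>v\<close> are
  conjugate to it, so the groups \<open>H\<^sub>w \<inter> K\<close> are infinite normal subgroups of \<open>K\<close>. There are finitely
  many of them and an element of all of them fixes the whole tree, so by faithfulness they intersect
  trivially. This is impossible in a non-elementary hyperbolic group, where two infinite normal
  subgroups of a finite-index subgroup always meet in an infinite group (\<open>infinite_Int_normal\<close>).
  Hence every \<open>H\<^sub>v\<close> is finite. Being normalized by a finite-index subgroup, it then consists of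
  elements with finitely many conjugates, and these form a finite subgroup, the FC-center, of any
  non-elementary hyperbolic group (\<open>finite_fc_center\<close>). So all \<open>H\<^sub>v\<close> lie in one finite set.

  Both facts on hyperbolic groups rest on elements \<open>g\<close> whose powers make definite progress
  (\<open>loxodromic\<close>), through two geometric results.

    \<^item> If \<open>x\<close> conjugates a nontrivial power of a loxodromic \<open>g\<close> to a power of \<open>g\<close>, then \<open>x\<close> lies within
      a distance of the powers of \<open>g\<close> that depends only on \<open>g\<close>
      (\<open>commensurator_close_to_axis\<close>). So all such \<open>x\<close> together are covered by finitely many
      cosets of a cyclic group.

    \<^item> Every infinite subgroup contains a loxodromic element (\<open>infinite_subgroup_has_loxodromic\<close>).

  If the FC-center is infinite, it contains a loxodromic element \<open>z\<close>; the centralizer of \<open>z\<close> has finite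
  index, and the first result makes the group virtually cyclic. If \<open>N\<close> and \<open>M\<close> are infinite, normal in
  \<open>K\<close>, and have a finite intersection, take a loxodromic \<open>m\<close> in \<open>M\<close>. The commutators of an element of
  \<open>N\<close> with the powers of \<open>m\<close> lie in \<open>N \<inter> M\<close>, so every element of \<open>N\<close> commutes with a nontrivial power
  of \<open>m\<close>. Hence finitely many cosets of the cyclic group of \<open>m\<close> cover \<open>N\<close>, which forces all
  elements of \<open>K\<close> to commensurate this cyclic group, and again the group is virtually cyclic.
\<close>

section \<open>Distances in connected graphs\<close>

lemma walk_betw_append:
  assumes "walk_betw V E x p y" "walk_betw V E y q z"
  shows "walk_betw V E x (p @ tl q) z \<and> length (p @ tl q) = length p + length q - 1"
proof -
  obtain q' where q: "q = y # q'" using assms(2) by (cases q) (auto simp: walk_betw_def)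
  show ?thesis
  proof (cases q')
    case Nil
    then show ?thesis using assms by (simp add: walk_betw_def q)
  next
    case (Cons z' q'')
    then show ?thesis using assms by (simp add: walk_betw_def q successively_append_iff)
  qed
qed

lemma walk_betw_rev:
  assumes "sym E" "walk_betw V E x p y"
  shows "walk_betw V E y (rev p) x"
proof -
  have "successively (\<lambda>u v. (v, u) \<in> E) p"
    using assms by (auto simp: walk_betw_def dest: symD intro: successively_mono)
  then have "successively (\<lambda>u v. (u, v) \<in> E) (rev p)" by simp
  then show ?thesis using assms(2) by (auto simp: walk_betw_def hd_rev last_rev)
qed

lemma walk_betw_map:
  assumes "walk_betw V E x p y" "\<And>v. v \<in> V \<Longrightarrow> f v \<in> V"
    "\<And>u v. \<lbrakk>u \<in> V; v \<in> V; (u, v) \<in> E\<rbrakk> \<Longrightarrow> (f u, f v) \<in> E"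
  shows "walk_betw V E (f x) (map f p) (f y)"
proof -
  have "successively (\<lambda>u v. (f u, f v) \<in> E) p"
  proof (rule successively_mono)
    show "successively (\<lambda>u v. (u, v) \<in> E) p" using assms(1) by (simp add: walk_betw_def)
    fix u v assume "u \<in> set p" "v \<in> set p" "(u, v) \<in> E"
    then show "(f u, f v) \<in> E" using assms(1) by (intro assms(3)) (auto simp: walk_betw_def)
  qed
  then show ?thesis
    using assms(1,2) by (auto simp: walk_betw_def successively_map hd_map last_map)
qed

lemma walk_betw_split:
  assumes "walk_betw V E x p y" "k < length p"
  shows "walk_betw V E x (take (Suc k) p) (p ! k)" "walk_betw V E (p ! k) (drop k p) y"
proof -
  have p: "p = take k p @ p ! k # drop (Suc k) p" using assms(2) by (rule id_take_nth_drop)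
  have s: "successively (\<lambda>u v. (u, v) \<in> E) (take k p @ p ! k # drop (Suc k) p)"
    using assms(1) p by (simp add: walk_betw_def)
  have t: "take (Suc k) p = take k p @ [p ! k]" using assms(2) by (rule take_Suc_conv_app_nth)
  have d: "drop k p = p ! k # drop (Suc k) p" using assms(2) by (simp add: Cons_nth_drop_Suc)
  have "hd (take (Suc k) p) = x" using assms by (cases p) (auto simp: walk_betw_def)
  moreover have "set (take (Suc k) p) \<subseteq> V" "set (drop k p) \<subseteq> V"
    using assms(1) by (auto simp: walk_betw_def dest: in_set_takeD in_set_dropD)
  moreover have "last (drop k p) = y" using assms by (simp add: walk_betw_def)
  ultimately show "walk_betw V E x (take (Suc k) p) (p ! k)" "walk_betw V E (p ! k) (drop k p) y"
    using s assms unfolding walk_betw_def t d by (auto simp: successively_append_iff successively_Cons)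
qed

lemma walk_betw_snoc_cases:
  assumes "walk_betw V E x p y" "length p = Suc (Suc n)"
  obtains z where "walk_betw V E x (butlast p) z" "length (butlast p) = Suc n" "(z, y) \<in> E"
proof
  define q where "q = butlast p"
  have p: "p = q @ [y]"
    using assms by (auto simp: walk_betw_def q_def append_butlast_last_id simp del: length_greater_0_conv)
  then have q: "q \<noteq> []" using assms(2) by auto
  show "walk_betw V E x (butlast p) (last (butlast p))" "(last (butlast p), y) \<in> E"
    using assms(1) q unfolding q_def[symmetric] p by (auto simp: walk_betw_def successively_append_iff)
  show "length (butlast p) = Suc n" using assms by simp
qed

lemma graph_dist_le:
  assumes "walk_betw V E x p y"
  shows "Suc (graph_dist V E x y) \<le> length p"
proof -
  have "length p = Suc (length p - 1)" using assms by (cases p) (auto simp: walk_betw_def)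
  moreover from this have "graph_dist V E x y \<le> length p - 1"
    unfolding graph_dist_def using assms by (intro Least_le) auto
  ultimately show ?thesis by simp
qed

lemma geodesic_exists:
  assumes "walk_betw V E x p y"
  shows "\<exists>q. geodesic_betw V E x q y"
proof -
  have "length p = Suc (length p - 1)" using assms by (cases p) (auto simp: walk_betw_def)
  then have "\<exists>n q. walk_betw V E x q y \<and> length q = Suc n" using assms by blast
  then have "\<exists>q. walk_betw V E x q y \<and> length q = Suc (graph_dist V E x y)"
    unfolding graph_dist_def by (rule LeastI_ex)
  then show ?thesis by (simp add: geodesic_betw_def)
qed

lemma graph_dist_self: "x \<in> V \<Longrightarrow> graph_dist V E x x = 0"
  using graph_dist_le[of V E x "[x]" x] by (simp add: walk_betw_def)

text \<open>
  The locally finite graphs in question are both the Cayley graph and the tree.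
\<close>

lemma finite_graph_sphere:
  assumes "\<And>v. v \<in> V \<Longrightarrow> finite (E `` {v})"
  shows "finite {v. \<exists>p. walk_betw V E x p v \<and> length p = Suc n}"
proof (induction n)
  case 0
  have "{v. \<exists>p. walk_betw V E x p v \<and> length p = Suc 0} \<subseteq> {x}"
    by (auto simp: walk_betw_def length_Suc_conv)
  then show ?case using finite_subset by blast
next
  case (Suc n)
  let ?A = "{v. \<exists>p. walk_betw V E x p v \<and> length p = Suc n}"
  have "{v. \<exists>p. walk_betw V E x p v \<and> length p = Suc (Suc n)} \<subseteq> (\<Union>z\<in>?A. E `` {z})"
  proof clarify
    fix v p assume "walk_betw V E x p v" "length p = Suc (Suc n)"
    then obtain z where "walk_betw V E x (butlast p) z" "length (butlast p) = Suc n" "(z, v) \<in> E"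
      by (rule walk_betw_snoc_cases)
    then show "v \<in> (\<Union>z\<in>?A. E `` {z})" by blast
  qed
  moreover have "?A \<subseteq> V"
    by (auto simp: walk_betw_def)
  then have "finite (\<Union>z\<in>?A. E `` {z})" using Suc assms by blast
  ultimately show ?case by (rule finite_subset)
qed

locale connected_undirected_graph =
  fixes V :: "'v set" and E :: "('v \<times> 'v) set"
  assumes sym_edges: "sym E" and connected: "connected_graph V E"
begin

lemma geodesic_obtain:
  assumes "x \<in> V" "y \<in> V"
  obtains p where "walk_betw V E x p y" "length p = Suc (graph_dist V E x y)"
proof -
  obtain p where "walk_betw V E x p y" using connected assms by (auto simp: connected_graph_def)
  from geodesic_exists[OF this] show ?thesis using that by (auto simp: geodesic_betw_def)
qed

lemma graph_dist_triangle:
  assumes "x \<in> V" "y \<in> V" "z \<in> V"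
  shows "graph_dist V E x z \<le> graph_dist V E x y + graph_dist V E y z"
proof -
  obtain p q where "walk_betw V E x p y" "length p = Suc (graph_dist V E x y)"
    "walk_betw V E y q z" "length q = Suc (graph_dist V E y z)"
    using geodesic_obtain assms by metis
  then show ?thesis
    using walk_betw_append[of V E x p y q z] graph_dist_le[of V E x "p @ tl q" z] by simp
qed

lemma graph_dist_sym:
  assumes "x \<in> V" "y \<in> V"
  shows "graph_dist V E x y = graph_dist V E y x"
proof -
  have "graph_dist V E y x \<le> graph_dist V E x y" if "x \<in> V" "y \<in> V" for x y
  proof -
    obtain p where p: "walk_betw V E x p y" "length p = Suc (graph_dist V E x y)"
      using geodesic_obtain \<open>x \<in> V\<close> \<open>y \<in> V\<close> by blast
    show ?thesis using graph_dist_le[OF walk_betw_rev[OF sym_edges p(1)]] p(2) by simp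
  qed
  then show ?thesis using assms by (simp add: order_antisym)
qed

lemma graph_dist_on_geodesic:
  assumes "walk_betw V E x p y" "length p = Suc (graph_dist V E x y)" "k \<le> graph_dist V E x y"
  shows "p ! k \<in> V" "graph_dist V E x (p ! k) = k" "graph_dist V E (p ! k) y = graph_dist V E x y - k"
proof -
  have k: "k < length p" using assms by simp
  show z: "p ! k \<in> V" using k assms(1) by (auto simp: walk_betw_def)
  have xy: "x \<in> V" "y \<in> V" using assms(1) by (auto simp: walk_betw_def)
  have "graph_dist V E x (p ! k) \<le> k"
    using graph_dist_le[OF walk_betw_split(1)[OF assms(1) k]] k by simp
  moreover have "graph_dist V E (p ! k) y \<le> graph_dist V E x y - k"
    using graph_dist_le[OF walk_betw_split(2)[OF assms(1) k]] assms(2,3) by simp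
  moreover note graph_dist_triangle[OF xy(1) z xy(2)]
  ultimately show "graph_dist V E x (p ! k) = k" "graph_dist V E (p ! k) y = graph_dist V E x y - k"
    using assms(3) by auto
qed

lemma finite_graph_ball:
  assumes "\<And>v. v \<in> V \<Longrightarrow> finite (E `` {v})" "x \<in> V"
  shows "finite {v \<in> V. graph_dist V E x v \<le> n}"
proof -
  have "{v \<in> V. graph_dist V E x v \<le> n}
      \<subseteq> (\<Union>k\<le>n. {v. \<exists>p. walk_betw V E x p v \<and> length p = Suc k})"
  proof clarify
    fix v assume "v \<in> V" "graph_dist V E x v \<le> n"
    then show "v \<in> (\<Union>k\<le>n. {v. \<exists>p. walk_betw V E x p v \<and> length p = Suc k})"
      using geodesic_obtain[OF assms(2), of v] by blast
  qed
  moreover have "finite (\<Union>k\<le>n. {v. \<exists>p. walk_betw V E x p v \<and> length p = Suc k})"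
    using finite_graph_sphere[OF assms(1)] by blast
  ultimately show ?thesis by (rule finite_subset)
qed

lemma graph_dist_map_le:
  assumes "x \<in> V" "y \<in> V" "\<And>v. v \<in> V \<Longrightarrow> f v \<in> V"
    "\<And>u v. \<lbrakk>u \<in> V; v \<in> V; (u, v) \<in> E\<rbrakk> \<Longrightarrow> (f u, f v) \<in> E"
  shows "graph_dist V E (f x) (f y) \<le> graph_dist V E x y"
proof -
  obtain p where "walk_betw V E x p y" "length p = Suc (graph_dist V E x y)"
    using geodesic_obtain assms by metis
  then show ?thesis
    using graph_dist_le[OF walk_betw_map[of V E x p y f]] assms(3,4) by simp
qed

end

section \<open>The word metric of a hyperbolic group\<close>

lemma (in group) mult_inv_cancel_left [simp]:
  assumes "x \<in> carrier G" "y \<in> carrier G"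
  shows "x \<otimes> (inv x \<otimes> y) = y" "inv x \<otimes> (x \<otimes> y) = y"
  using assms by (simp_all add: m_assoc[symmetric])

text \<open>
  All that the hyperbolic geometry below needs to know about the word metric. The hyperbolicity
  condition is the four-point inequality: of the three ways to pair up four points, the two largest sums
  of distances differ by at most \<open>2\<delta>\<close>. Points on geodesics are needed only at integer distances from the end.
\<close>

locale hyperbolic_metric_group = group G for G :: "('g, 'b) monoid_scheme" (structure) +
  fixes dst :: "'g \<Rightarrow> 'g \<Rightarrow> real" and \<delta> :: real
  assumes delta_nonneg: "0 \<le> \<delta>"
    and dst_nonneg: "\<lbrakk>x \<in> carrier G; y \<in> carrier G\<rbrakk> \<Longrightarrow> 0 \<le> dst x y"
    and dst_self: "x \<in> carrier G \<Longrightarrow> dst x x = 0"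
    and dst_sym: "\<lbrakk>x \<in> carrier G; y \<in> carrier G\<rbrakk> \<Longrightarrow> dst x y = dst y x"
    and dst_triangle: "\<lbrakk>x \<in> carrier G; y \<in> carrier G; z \<in> carrier G\<rbrakk> \<Longrightarrow> dst x z \<le> dst x y + dst y z"
    and dst_left_mult: "\<lbrakk>g \<in> carrier G; x \<in> carrier G; y \<in> carrier G\<rbrakk> \<Longrightarrow> dst (g \<otimes> x) (g \<otimes> y) = dst x y"
    and finite_ball: "finite {g \<in> carrier G. dst \<one> g \<le> R}"
    and geodesic_point: "\<lbrakk>g \<in> carrier G; real k \<le> dst \<one> g\<rbrakk>
          \<Longrightarrow> \<exists>x\<in>carrier G. dst \<one> x = real k \<and> dst x g = dst \<one> g - real k"
    and four_point: "\<lbrakk>x \<in> carrier G; y \<in> carrier G; z \<in> carrier G; w \<in> carrier G\<rbrakk>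
          \<Longrightarrow> dst x y + dst z w \<le> max (dst x z + dst y w) (dst x w + dst y z) + 2 * \<delta>"

context group
begin

lemma sym_cayley_edges: "sym (cayley_edges G S)"
  unfolding sym_def cayley_edges_def by blast

lemma cayley_walk_exists:
  assumes S: "S \<subseteq> carrier G" and h: "h \<in> generate G S" and x: "x \<in> carrier G"
  shows "\<exists>p. walk_betw (carrier G) (cayley_edges G S) x p (x \<otimes> h)"
  using h x
proof (induction arbitrary: x rule: generate.induct)
  case one
  then have "walk_betw (carrier G) (cayley_edges G S) x [x] (x \<otimes> \<one>)" by (simp add: walk_betw_def)
  then show ?case by blast
next
  case (incl h)
  then have h: "h \<in> carrier G" using S by auto
  show ?case
  proof (cases "x = x \<otimes> h")
    case True
    then have "walk_betw (carrier G) (cayley_edges G S) x [x] (x \<otimes> h)"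
      using incl by (simp add: walk_betw_def)
    then show ?thesis by blast
  next
    case False
    then have "walk_betw (carrier G) (cayley_edges G S) x [x, x \<otimes> h] (x \<otimes> h)"
      using incl h by (auto simp: walk_betw_def cayley_edges_def)
    then show ?thesis by blast
  qed
next
  case (inv h)
  then have h: "h \<in> carrier G" using S by auto
  show ?case
  proof (cases "x = x \<otimes> inv h")
    case True
    then have "walk_betw (carrier G) (cayley_edges G S) x [x] (x \<otimes> inv h)"
      using inv by (simp add: walk_betw_def)
    then show ?thesis by blast
  next
    case False
    then have "walk_betw (carrier G) (cayley_edges G S) x [x, x \<otimes> inv h] (x \<otimes> inv h)"
      using inv h by (auto simp: walk_betw_def cayley_edges_def m_assoc intro!: bexI[of _ h])
    then show ?thesis by blast
  qed
next
  case (eng h1 h2)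
  have car: "h1 \<in> carrier G" "h2 \<in> carrier G" using eng.hyps generate_in_carrier[OF S] by auto
  obtain p q where "walk_betw (carrier G) (cayley_edges G S) x p (x \<otimes> h1)"
    "walk_betw (carrier G) (cayley_edges G S) (x \<otimes> h1) q (x \<otimes> h1 \<otimes> h2)"
    using eng.IH(1)[OF eng.prems] eng.IH(2)[of "x \<otimes> h1"] eng.prems car by blast
  then show ?case using walk_betw_append eng.prems car by (metis m_assoc)
qed

lemma finite_cayley_neighbours:
  assumes "finite S" "S \<subseteq> carrier G" "g \<in> carrier G"
  shows "finite (cayley_edges G S `` {g})"
proof -
  have "cayley_edges G S `` {g} \<subseteq> (\<lambda>s. g \<otimes> s) ` S \<union> (\<lambda>s. g \<otimes> inv s) ` S"
    using assms by (force simp: cayley_edges_def m_assoc)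
  then show ?thesis using assms(1) finite_subset by blast
qed

lemma cayley_edges_left_mult:
  assumes "g \<in> carrier G" "S \<subseteq> carrier G" "(u, v) \<in> cayley_edges G S"
  shows "(g \<otimes> u, g \<otimes> v) \<in> cayley_edges G S"
proof -
  have car: "u \<in> carrier G" "v \<in> carrier G" "u \<noteq> v" using assms(3) by (auto simp: cayley_edges_def)
  obtain s where s: "s \<in> S" "v = u \<otimes> s \<or> u = v \<otimes> s" using assms(3) by (auto simp: cayley_edges_def)
  have "g \<otimes> v = g \<otimes> u \<otimes> s \<or> g \<otimes> u = g \<otimes> v \<otimes> s"
    using s car assms(1,2) by (auto simp: m_assoc subset_iff)
  then show ?thesis using s car assms(1) by (auto simp: cayley_edges_def)
qed

end

lemma hyperbolic_group_imp_metric: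
  fixes G (structure)
  assumes "hyperbolic_group G"
  obtains dst \<delta> where "hyperbolic_metric_group G dst \<delta>"
proof -
  interpret group G using assms by (simp add: hyperbolic_group_def)
  obtain S where S: "finite S" "S \<subseteq> carrier G" "generate G S = carrier G"
    "Gromov_hyperbolic_on (carrier G) (word_metric G S)"
    using assms by (auto simp: hyperbolic_group_def)
  define D where "D = graph_dist (carrier G) (cayley_edges G S)"
  have conn: "connected_graph (carrier G) (cayley_edges G S)"
    unfolding connected_graph_def
  proof (intro conjI ballI)
    show "carrier G \<noteq> {}" using one_closed by blast
    fix x y assume xy: "x \<in> carrier G" "y \<in> carrier G"
    then show "\<exists>p. walk_betw (carrier G) (cayley_edges G S) x p y"
      using cayley_walk_exists[OF S(2), of "inv x \<otimes> y" x] S(3) by simp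
  qed
  interpret Cay: connected_undirected_graph "carrier G" "cayley_edges G S"
    by unfold_locales (auto simp: sym_cayley_edges conn)
  obtain \<delta> where \<delta>: "\<delta> \<ge> 0"
    "\<And>w x y z. \<lbrakk>w \<in> carrier G; x \<in> carrier G; y \<in> carrier G; z \<in> carrier G\<rbrakk> \<Longrightarrow>
      Gromov_product (word_metric G S) w x z
        \<ge> min (Gromov_product (word_metric G S) w x y) (Gromov_product (word_metric G S) w y z) - \<delta>"
    using S(4) unfolding Gromov_hyperbolic_on_def by blast
  have D: "word_metric G S x y = real (D x y)" for x y by (simp add: word_metric_def D_def)
  have Dsym: "D x y = D y x" if "x \<in> carrier G" "y \<in> carrier G" for x y
    using Cay.graph_dist_sym that by (simp add: D_def)
  have "hyperbolic_metric_group G (word_metric G S) \<delta>"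
  proof unfold_locales
    show "0 \<le> \<delta>" by fact
    fix x assume x: "x \<in> carrier G"
    show "word_metric G S x x = 0" using x by (simp add: D D_def graph_dist_self)
    fix y assume y: "y \<in> carrier G"
    show "0 \<le> word_metric G S x y" by (simp add: D)
    show "word_metric G S x y = word_metric G S y x" using Dsym x y by (simp add: D)
    fix z assume z: "z \<in> carrier G"
    show "word_metric G S x z \<le> word_metric G S x y + word_metric G S y z"
      using Cay.graph_dist_triangle[OF x y z] by (simp add: D D_def)
    have le: "D (g \<otimes> u) (g \<otimes> v) \<le> D u v" if "g \<in> carrier G" "u \<in> carrier G" "v \<in> carrier G" for g u v
      unfolding D_def by (rule Cay.graph_dist_map_le) (use that S cayley_edges_left_mult in auto)
    show "word_metric G S (x \<otimes> y) (x \<otimes> z) = word_metric G S y z"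
      using le[of x y z] le[of "inv x" "x \<otimes> y" "x \<otimes> z"] x y z by (simp add: D m_assoc[symmetric])
    fix w assume w: "w \<in> carrier G"
    show "word_metric G S x y + word_metric G S z w
      \<le> max (word_metric G S x z + word_metric G S y w) (word_metric G S x w + word_metric G S y z) + 2 * \<delta>"
    proof -
      have "g + b \<le> max (c + e) (a + f) + 2 * \<delta>"
        if "min ((a + b - c) / 2) ((b + e - f) / 2) - \<delta> \<le> (a + e - g) / 2" for a b c e f g :: real
        using that by (auto simp: min_def max_def field_simps split: if_splits)
      from this[OF \<delta>(2)[OF w x z y, unfolded Gromov_product_def D Dsym[OF z y] Dsym[OF z w]]]
      show ?thesis unfolding D Dsym[OF z w] .
    qed
  next
    fix R :: real
    have "{g \<in> carrier G. word_metric G S \<one> g \<le> R} \<subseteq> {g \<in> carrier G. D \<one> g \<le> nat \<lfloor>R\<rfloor>}"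
      by (auto simp: D le_nat_floor)
    moreover have "finite {g \<in> carrier G. D \<one> g \<le> nat \<lfloor>R\<rfloor>}"
      unfolding D_def using finite_cayley_neighbours S by (intro Cay.finite_graph_ball) auto
    ultimately show "finite {g \<in> carrier G. word_metric G S \<one> g \<le> R}" by (rule finite_subset)
  next
    fix g and k :: nat
    assume g: "g \<in> carrier G" and "real k \<le> word_metric G S \<one> g"
    then have k: "k \<le> graph_dist (carrier G) (cayley_edges G S) \<one> g" by (simp add: D D_def)
    obtain p where p: "walk_betw (carrier G) (cayley_edges G S) \<one> p g"
      "length p = Suc (graph_dist (carrier G) (cayley_edges G S) \<one> g)"
      using Cay.geodesic_obtain[OF one_closed g] by blast
    show "\<exists>x\<in>carrier G. word_metric G S \<one> x = real k \<and> word_metric G S x g = word_metric G S \<one> g - real k"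
      using Cay.graph_dist_on_geodesic[OF p k] k
      by (intro bexI[of _ "p ! k"]) (auto simp: D D_def of_nat_diff)
  qed
  then show ?thesis by (rule that)
qed

section \<open>Loxodromic elements and their commensurators\<close>

context hyperbolic_metric_group
begin

abbreviation len :: "'g \<Rightarrow> real" where "len g \<equiv> dst \<one> g"

lemma dst_eq_len: "\<lbrakk>x \<in> carrier G; y \<in> carrier G\<rbrakk> \<Longrightarrow> dst x y = len (inv x \<otimes> y)"
  using dst_left_mult[of "inv x" x y] by simp

lemma len_inv: "x \<in> carrier G \<Longrightarrow> len (inv x) = len x"
  using dst_left_mult[of x \<one> "inv x"] dst_sym[of x \<one>] by simp

lemma len_mult_le: "\<lbrakk>x \<in> carrier G; y \<in> carrier G\<rbrakk> \<Longrightarrow> len (x \<otimes> y) \<le> len x + len y"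
  using dst_triangle[of \<one> x "x \<otimes> y"] dst_left_mult[of x \<one> y] by simp

lemma dst_mult_right: "\<lbrakk>x \<in> carrier G; y \<in> carrier G\<rbrakk> \<Longrightarrow> dst x (x \<otimes> y) = len y"
  using dst_left_mult[of x \<one> y] by simp

lemma int_pow_conj:
  assumes "x \<in> carrier G" "h \<in> carrier G"
  shows "(x \<otimes> h \<otimes> inv x) [^] (k::int) = x \<otimes> h [^] k \<otimes> inv x"
proof -
  have "(\<lambda>h. x \<otimes> h \<otimes> inv x) \<in> hom G G"
    using assms(1) by (auto simp: hom_def m_assoc inv_solve_left)
  then show ?thesis
    using hom_int_pow[of "\<lambda>h. x \<otimes> h \<otimes> inv x" G G h k] assms(2) is_group by simp
qed

lemma dst_pow: "g \<in> carrier G \<Longrightarrow> dst (g [^] (i::int)) (g [^] (j::int)) = len (g [^] (j - i))"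
  using dst_left_mult[of "g [^] i" \<one> "g [^] (j - i)"] by (simp add: int_pow_mult[symmetric])

lemma len_pow_uminus: "g \<in> carrier G \<Longrightarrow> len (g [^] (- i::int)) = len (g [^] i)"
  by (simp add: int_pow_neg len_inv)

lemma len_pow_abs: "g \<in> carrier G \<Longrightarrow> len (g [^] \<bar>i::int\<bar>) = len (g [^] i)"
  by (simp add: abs_if len_pow_uminus)

text \<open>
  The condition says that twice the Gromov product of \<open>g\<close> and its inverse at the identity, which is
  \<open>2|g| - |g\<^sup>2|\<close>, is at most \<open>|g| - 3\<delta> - 1\<close>. With this margin below the step length \<open>|g|\<close>, the absence of
  backtracking in two consecutive steps of the orbit \<open>1, g, g\<^sup>2, \<dots>\<close> propagates to the whole orbit.
\<close>

definition loxodromic :: "'g \<Rightarrow> bool" where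
  "loxodromic g \<longleftrightarrow> g \<in> carrier G \<and> len (g \<otimes> g) \<ge> len g + 3 * \<delta> + 1"

text \<open>
  Induction with the four-point inequality for \<open>1, g, g\<^sup>2, g\<^sup>n\<^sup>+\<^sup>2\<close>: progress from \<open>g\<^sup>n\<close> to \<open>g\<^sup>n\<^sup>+\<^sup>1\<close> and the
  margin in \<open>|g\<^sup>2|\<close> exclude the sum in which \<open>g\<^sup>2\<close> and \<open>g\<^sup>n\<^sup>+\<^sup>2\<close> are paired.
\<close>

lemma loxodromic_pow_step:
  assumes "loxodromic g"
  shows "len (g [^] (int n + 1)) \<ge> len (g [^] (int n)) + \<delta> + 1"
proof (induction n)
  case 0
  have "g \<in> carrier G" "len (g \<otimes> g) \<ge> len g + 3 * \<delta> + 1"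
    using assms by (auto simp: loxodromic_def)
  then show ?case using len_mult_le[of g g] delta_nonneg by (simp add: dst_self)
next
  case (Suc n)
  have g: "g \<in> carrier G" and g2: "len (g [^] (2::int)) \<ge> len g + 3 * \<delta> + 1"
    using assms int_pow_mult[of g 1 1] by (auto simp: loxodromic_def)
  have fp: "dst (g [^] (0::int)) (g [^] (2::int)) + dst (g [^] (1::int)) (g [^] (int n + 2))
      \<le> max (dst (g [^] (0::int)) (g [^] (1::int)) + dst (g [^] (2::int)) (g [^] (int n + 2)))
          (dst (g [^] (0::int)) (g [^] (int n + 2)) + dst (g [^] (2::int)) (g [^] (1::int))) + 2 * \<delta>"
    by (rule four_point) (use g in auto)
  have l: "dst (g [^] (2::int)) (g [^] (1::int)) = len g"
    using g len_pow_uminus[OF g, of 1] dst_pow[OF g, of 2 1] by simp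
  have "len (g [^] (2::int)) + len (g [^] (int n + 1))
      \<le> max (len g + len (g [^] (int n))) (len (g [^] (int n + 2)) + len g) + 2 * \<delta>"
    using fp unfolding l using g by (simp only: dst_pow) (simp add: algebra_simps)
  then show ?case using Suc g2 delta_nonneg by (auto simp: algebra_simps max_def split: if_splits)
qed

lemma loxodromic_len_pow_ge:
  assumes "loxodromic g"
  shows "len (g [^] (i::int)) \<ge> real_of_int \<bar>i\<bar>"
proof -
  have "len (g [^] (int n)) \<ge> real n" for n
  proof (induction n)
    case 0
    then show ?case by (simp add: dst_self)
  next
    case (Suc n)
    then show ?case using loxodromic_pow_step[OF assms, of n] delta_nonneg by (simp add: add.commute)
  qed
  from this[of "nat \<bar>i\<bar>"] show ?thesis
    using assms len_pow_abs[of g i] by (simp add: loxodromic_def)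
qed

text \<open>
  In the four-point inequality for \<open>g\<^sup>-\<^sup>i, g\<^sup>-\<^sup>1, 1, g\<^sup>k\<close>, progress towards both sides excludes the sum in
  which \<open>g\<^sup>-\<^sup>i\<close> is paired with \<open>g\<^sup>-\<^sup>1\<close>. The powers of \<open>g\<close> thus form a quasigeodesic line: twice the Gromov product of \<open>g\<^sup>-\<^sup>i\<close> and \<open>g\<^sup>k\<close> at the identity
  is bounded by a constant independent of \<open>i\<close> and \<open>k\<close>.
\<close>

lemma loxodromic_len_pow_add:
  assumes "loxodromic g"
  shows "len (g [^] (int i + int k)) \<ge> len (g [^] (int i)) + len (g [^] (int k)) - (len g + 2 * \<delta>)"
proof (cases i)
  case 0
  have "0 \<le> len g" using assms dst_nonneg by (simp add: loxodromic_def)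
  then show ?thesis using delta_nonneg 0 by (simp add: dst_self)
next
  case (Suc i')
  have g: "g \<in> carrier G" using assms by (auto simp: loxodromic_def)
  have fp: "dst (g [^] (- int i)) (g [^] (0::int)) + dst (g [^] (-1::int)) (g [^] int k)
      \<le> max (dst (g [^] (- int i)) (g [^] (-1::int)) + dst (g [^] (0::int)) (g [^] int k))
          (dst (g [^] (- int i)) (g [^] int k) + dst (g [^] (0::int)) (g [^] (-1::int))) + 2 * \<delta>"
    by (rule four_point) (use g in auto)
  have l: "dst (g [^] (0::int)) (g [^] (-1::int)) = len g"
    using g len_pow_uminus[OF g, of 1] dst_pow[OF g, of 0 "-1"] by simp
  have "len (g [^] int i) + len (g [^] (int k + 1))
      \<le> max (len (g [^] int i') + len (g [^] int k)) (len (g [^] (int i + int k)) + len g) + 2 * \<delta>"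
    using fp unfolding l using g Suc by (simp only: dst_pow) (simp add: algebra_simps)
  then show ?thesis
    using loxodromic_pow_step[OF assms, of i'] loxodromic_pow_step[OF assms, of k] Suc delta_nonneg
    by (auto simp: algebra_simps max_def split: if_splits)
qed

lemma loxodromic_pow_inj:
  assumes "loxodromic g" "g [^] (i::int) = g [^] (j::int)"
  shows "i = j"
proof -
  have g: "g \<in> carrier G" using assms by (auto simp: loxodromic_def)
  have "len (g [^] (j - i)) = 0" using dst_pow[OF g, of i j] assms(2) g by (simp add: dst_self)
  then show ?thesis using loxodromic_len_pow_ge[OF assms(1), of "j - i"] by simp
qed

text \<open>
  A point that is nearly between two powers of \<open>g\<close> is compared with the power of \<open>g\<close> that has about the same
  distance from one of them. It exists because successive powers have distance \<open>|g|\<close>, so that a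
  discrete intermediate value argument applies. Two points nearly between the same ends and at about the
  same distance from one end are close by hyperbolicity.
\<close>

lemma close_to_loxodromic_axis:
  assumes lox: "loxodromic g" and x: "x \<in> carrier G" and qp: "q \<le> p" and c: "0 \<le> c"
    and between: "dst x (g [^] (q::int)) + dst x (g [^] (p::int)) \<le> dst (g [^] q) (g [^] p) + c"
  shows "\<exists>i::int. dst x (g [^] i) \<le> c + len g + 4 * \<delta>"
proof -
  have g: "g \<in> carrier G" using lox by (auto simp: loxodromic_def)
  define a where "a = (\<lambda>k::nat. len (g [^] int k))"
  define n where "n = nat (p - q)"
  have n: "p = q + int n" using qp by (simp add: n_def)
  define u where "u = dst x (g [^] q)"
  have dpq: "dst (g [^] q) (g [^] p) = a n" using g by (simp add: dst_pow n a_def)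
  have L0: "0 \<le> len g" using g dst_nonneg by simp
  have "0 \<le> dst x (g [^] p)" using dst_nonneg x g by simp
  then have an: "a n \<ge> u - c" using between by (simp add: dpq u_def)
  \<comment> \<open>The threshold \<open>u - c\<close> is reached at the latest at the other end \<open>g\<^sup>p\<close>; at the first \<open>k\<close> that
    reaches it, \<open>a k\<close> is larger than \<open>u\<close> by at most one step.\<close>
  define k where "k = (LEAST k. a k \<ge> u - c)"
  have k: "a k \<ge> u - c" unfolding k_def using an by (rule LeastI)
  have kn: "k \<le> n" unfolding k_def using an by (rule Least_le)
  have ak: "a k \<le> u + len g"
  proof (cases k)
    case 0
    have "0 \<le> u" using dst_nonneg x g by (simp add: u_def)
    then show ?thesis using 0 L0 by (simp add: a_def dst_self)
  next
    case (Suc k')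
    have "\<not> a k' \<ge> u - c" using Suc not_less_Least[of k' "\<lambda>k. a k \<ge> u - c"] by (simp add: k_def)
    moreover have "a k \<le> a k' + len g"
      using len_mult_le[of "g [^] int k'" g] g int_pow_mult[OF g, of "int k'" 1]
      by (simp add: Suc a_def add.commute)
    ultimately show ?thesis using c by simp
  qed
  define y where "y = g [^] (q + int k)"
  have y: "y \<in> carrier G" using g by (simp add: y_def)
  have yq: "dst y (g [^] q) = a k"
    using len_pow_uminus[OF g, of "int k"] g by (simp add: y_def dst_pow a_def)
  have yp: "dst y (g [^] p) = a (n - k)"
    using kn g by (simp add: y_def dst_pow n a_def of_nat_diff)
  have "int k + int (n - k) = int n" using kn by simp
  then have "a n \<ge> a k + a (n - k) - (len g + 2 * \<delta>)"
    using loxodromic_len_pow_add[OF lox, of k "n - k"] by (simp add: a_def)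
  moreover have "dst x y + dst (g [^] q) (g [^] p)
      \<le> max (dst x (g [^] q) + dst y (g [^] p)) (dst x (g [^] p) + dst y (g [^] q)) + 2 * \<delta>"
    by (rule four_point) (use x y g in auto)
  ultimately have "dst x y \<le> c + len g + 4 * \<delta>"
    using between k ak delta_nonneg unfolding yq yp dpq u_def by linarith
  then show ?thesis unfolding y_def by blast
qed

text \<open>
  The equation makes the far ends \<open>x g\<^sup>a\<^sup>N\<close>, \<open>x g\<^sup>-\<^sup>a\<^sup>N\<close> of the translated axis stay at distance \<open>|x|\<close> from
  the powers \<open>g\<^sup>b\<^sup>N\<close>, \<open>g\<^sup>-\<^sup>b\<^sup>N\<close>. Now \<open>x\<close> is nearly between the former two. When \<open>N\<close> is large compared with
  \<open>|x|\<close>, hyperbolicity allows replacing them by the latter two at a cost that is independent of \<open>x\<close>.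
\<close>

lemma commensurator_close_to_axis:
  assumes lox: "loxodromic g" and x: "x \<in> carrier G" and a: "(a::int) \<noteq> 0"
    and comm: "x \<otimes> g [^] a = g [^] (b::int) \<otimes> x"
  shows "\<exists>i::int. dst x (g [^] i) \<le> 2 * len g + 10 * \<delta>"
proof -
  have g: "g \<in> carrier G" using lox by (auto simp: loxodromic_def)
  define D where "D = len g + 2 * \<delta>"
  have D0: "0 \<le> D" using dst_nonneg g delta_nonneg by (simp add: D_def)
  have conj: "x \<otimes> g [^] (a * k) = g [^] (b * k) \<otimes> x" for k :: int
  proof -
    have ba: "g [^] b = x \<otimes> g [^] a \<otimes> inv x" using comm x g by (simp add: m_assoc)
    have "g [^] (b * k) = x \<otimes> g [^] (a * k) \<otimes> inv x"
      using int_pow_conj[of x "g [^] a" k] ba x g by (simp add: int_pow_pow[OF g, symmetric])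
    then show ?thesis using x g by (simp add: m_assoc)
  qed
  define lx where "lx = len x"
  define N where "N = nat \<lceil>2 * lx + D + 2 * \<delta> + 1\<rceil>"
  define P where "P = g [^] (b * int N)"
  define Q where "Q = g [^] (- (b * int N))"
  define P' where "P' = x \<otimes> g [^] (a * int N)"
  define Q' where "Q' = x \<otimes> g [^] (- (a * int N))"
  note defs = P_def Q_def P'_def Q'_def
  have car: "P \<in> carrier G" "Q \<in> carrier G" "P' \<in> carrier G" "Q' \<in> carrier G"
    using x g by (auto simp: defs)
  have PP: "dst P P' = lx"
    unfolding P_def P'_def conj using x g by (simp add: dst_mult_right lx_def)
  have QQ: "dst Q Q' = lx"
    unfolding Q_def Q'_def using conj[of "- int N"] x g by (simp add: dst_mult_right lx_def)
  define \<alpha> where "\<alpha> = len (g [^] (a * int N))"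
  have xP': "dst x P' = \<alpha>" using x g by (simp add: P'_def \<alpha>_def dst_mult_right)
  have xQ': "dst x Q' = \<alpha>" using x g by (simp add: Q'_def \<alpha>_def dst_mult_right len_pow_uminus)
  have PQ': "dst P' Q' \<ge> 2 * \<alpha> - D"
  proof -
    define m where "m = nat \<bar>a * int N\<bar>"
    have m: "int m = \<bar>a * int N\<bar>" by (simp add: m_def)
    have "dst P' Q' = len (g [^] (- (2 * (a * int N))))"
      using x g by (simp add: P'_def Q'_def dst_left_mult dst_pow)
    also have "\<dots> = len (g [^] \<bar>2 * (a * int N)\<bar>)" using len_pow_abs[OF g] len_pow_uminus[OF g] by metis
    also have "\<bar>2 * (a * int N)\<bar> = int m + int m" using m by simp
    finally show ?thesis
      using loxodromic_len_pow_add[OF lox, of m m] len_pow_abs[OF g, of "a * int N"] m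
      by (simp add: D_def \<alpha>_def)
  qed
  have "\<alpha> \<ge> real_of_int \<bar>a * int N\<bar>" unfolding \<alpha>_def by (rule loxodromic_len_pow_ge[OF lox])
  moreover have "real_of_int \<bar>a * int N\<bar> \<ge> real N"
  proof -
    have "\<bar>a\<bar> \<ge> 1" using a by simp
    then have "\<bar>a\<bar> * int N \<ge> 1 * int N" by (rule mult_right_mono) simp
    then have "int N \<le> \<bar>a * int N\<bar>" by (simp add: abs_mult)
    then have "real_of_int (int N) \<le> real_of_int \<bar>a * int N\<bar>" by (simp only: of_int_le_iff)
    then show ?thesis by simp
  qed
  moreover have "real N \<ge> 2 * lx + D + 2 * \<delta> + 1" unfolding N_def by linarith
  ultimately have \<alpha>: "\<alpha> \<ge> 2 * lx + D + 2 * \<delta> + 1" by linarith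
  have lx0: "0 \<le> lx" using dst_nonneg x by (simp add: lx_def)
  have xP: "dst x P \<ge> \<alpha> - lx" using dst_triangle[of x P P'] x car xP' PP by simp
  have xQ: "dst x Q \<ge> \<alpha> - lx" using dst_triangle[of x Q Q'] x car xQ' QQ by simp
  have "dst x P + dst P' Q' \<le> max (dst x P' + dst P Q') (dst x Q' + dst P P') + 2 * \<delta>"
    by (rule four_point) (use x car in auto)
  \<comment> \<open>Replace one end of the translated axis, then the other; the excluded sums are too small
    because \<open>\<alpha>\<close> is large compared with \<open>|x|\<close>.\<close>
  then have PQ1: "dst P Q' \<ge> dst x P + \<alpha> - D - 2 * \<delta>"
    using xP' xQ' PP PQ' xP \<alpha> lx0 delta_nonneg D0 by linarith
  have "dst x Q + dst P Q' \<le> max (dst x P + dst Q Q') (dst x Q' + dst Q P) + 2 * \<delta>"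
    by (rule four_point) (use x car in auto)
  then have PQ: "dst x P + dst x Q \<le> dst Q P + (D + 4 * \<delta>)"
    using xQ' QQ PQ1 xQ \<alpha> lx0 delta_nonneg D0 by linarith
  have c0: "0 \<le> D + 4 * \<delta>" using D0 delta_nonneg by simp
  have bound: "D + 4 * \<delta> + len g + 4 * \<delta> = 2 * len g + 10 * \<delta>" by (simp add: D_def)
  have "\<exists>i::int. dst x (g [^] i) \<le> D + 4 * \<delta> + len g + 4 * \<delta>"
  proof (cases "- (b * int N) \<le> b * int N")
    case True
    show ?thesis
      by (rule close_to_loxodromic_axis[OF lox x True c0]) (use PQ in \<open>simp add: P_def Q_def\<close>)
  next
    case False
    then have le: "b * int N \<le> - (b * int N)" by simp
    show ?thesis
      by (rule close_to_loxodromic_axis[OF lox x le c0])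
        (use PQ dst_sym[OF car(1,2)] in \<open>simp add: P_def Q_def\<close>)
  qed
  then show ?thesis unfolding bound .
qed

section \<open>Loxodromic elements in infinite subgroups\<close>

text \<open>
  The expressions are twice the Gromov products at the identity, so this is the inequality that defines
  hyperbolicity, with base point \<open>\<one>\<close>.
\<close>

lemma double_product_ineq:
  assumes "x \<in> carrier G" "y \<in> carrier G" "z \<in> carrier G"
  shows "len x + len z - dst x z \<ge> min (len x + len y - dst x y) (len y + len z - dst y z) - 2 * \<delta>"
  using four_point[of x z y \<one>] assms dst_sym[of x \<one>] dst_sym[of y \<one>] dst_sym[of z \<one>]
    dst_sym[of z y] by simp

lemma double_product_ineq4:
  assumes "x \<in> carrier G" "y \<in> carrier G" "z \<in> carrier G" "w \<in> carrier G"
    and "t \<le> len x + len y - dst x y" "t \<le> len y + len z - dst y z" "t \<le> len z + len w - dst z w"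
  shows "t \<le> len x + len w - dst x w + 4 * \<delta>"
  using double_product_ineq[OF assms(1-3)] double_product_ineq[OF assms(1,3,4)] assms(5-7) delta_nonneg
  by linarith

text \<open>
  For \<open>k = g\<close>, \<open>k = h\<close> and \<open>k = u\<close> with \<open>u = g\<^sup>-\<^sup>1 h\<close>, the Gromov product of \<open>k\<close> and its inverse at the
  identity is at least about \<open>|k|/2\<close>, as \<open>k\<close> is not loxodromic. The chain
  \<open>g\<^sup>-\<^sup>1, u, u\<^sup>-\<^sup>1, h\<^sup>-\<^sup>1\<close> bounds the product of \<open>g\<^sup>-\<^sup>1\<close> and \<open>h\<^sup>-\<^sup>1\<close> from below by a quantity that grows as
  \<open>(g|h)\<close> decreases, and the chain \<open>g, g\<^sup>-\<^sup>1, h\<^sup>-\<^sup>1, h\<close> carries this bound back to \<open>(g|h)\<close>. Together,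
  \<open>(g|h)\<close> is at least half the smaller length, up to a constant: \<open>M\<close> moves the identity in a single
  direction.
\<close>

lemma product_large_if_no_loxodromic:
  assumes M: "subgroup M G" and nolox: "\<And>g. g \<in> M \<Longrightarrow> \<not> loxodromic g"
    and gM: "g \<in> M" and hM: "h \<in> M"
  shows "dst g h \<le> max (len g) (len h) + 7 * \<delta> + 1"
proof -
  interpret M: subgroup M G by (rule M)
  have car: "g \<in> carrier G" "h \<in> carrier G" using gM hM by auto
  have sq: "len (k \<otimes> k) \<le> len k + 3 * \<delta> + 1" if "k \<in> M" for k
    using nolox[OF that] that by (auto simp: loxodromic_def)
  define u where "u = inv g \<otimes> h"
  have uM: "u \<in> M" using gM hM by (simp add: u_def)
  have u: "u \<in> carrier G" using uM by auto
  have iu: "inv u = inv h \<otimes> g" using car by (simp add: u_def inv_mult_group)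
  have lu: "len u = dst g h" using car dst_eq_len[of g h] by (simp add: u_def)
  have antipodal: "dst k (inv k) = len (k \<otimes> k)" if "k \<in> carrier G" for k
    using that dst_eq_len[of "inv k" k] dst_sym[of k "inv k"] by simp
  have antipodal': "dst (inv k) k = len (k \<otimes> k)" if "k \<in> carrier G" for k
    using that dst_eq_len[of "inv k" k] by simp
  have 1: "dst (inv g) u = len h" using car by (simp add: u_def dst_mult_right)
  have 2: "dst (inv u) (inv h) = len g"
    using car dst_sym[of "inv u" "inv h"] dst_mult_right[of "inv h" g] u by (simp add: iu)
  have "len u - \<bar>len g - len h\<bar> - 3 * \<delta> - 1 \<le> len (inv g) + len (inv h) - dst (inv g) (inv h) + 4 * \<delta>"
    by (rule double_product_ineq4[of _ u "inv u"])
      (use car u sq[OF uM] delta_nonneg in \<open>auto simp: 1 2 antipodal antipodal' len_inv\<close>)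
  then have "min (min (len g) (len h) - 3 * \<delta> - 1) (len u - \<bar>len g - len h\<bar> - 7 * \<delta> - 1)
      \<le> len g + len h - dst g h + 4 * \<delta>"
    by (intro double_product_ineq4[of _ "inv g" "inv h"])
      (use car sq[OF gM] sq[OF hM] in \<open>auto simp: antipodal antipodal' len_inv min_def\<close>)
  then show ?thesis unfolding lu using delta_nonneg by (auto simp: min_def max_def split: if_splits)
qed

text \<open>
  The conjugating element need not lie in \<open>M\<close>, so being loxodromic has to be detected in a conjugation
  invariant way: without loxodromic elements squaring lengthens by a constant only, so the length of
  the power of \<open>u\<close> with exponent \<open>2^k\<close> grows at most linearly in \<open>k\<close>, whereas the powers of a loxodromic
  element have length at least their exponent, and conjugating them changes this by a constant only.
\<close>

lemma conj_not_loxodromic: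
  assumes M: "subgroup M G" and nolox: "\<And>g. g \<in> M \<Longrightarrow> \<not> loxodromic g"
    and uM: "u \<in> M" and x: "x \<in> carrier G"
  shows "\<not> loxodromic (inv x \<otimes> u \<otimes> x)"
proof
  interpret M: subgroup M G by (rule M)
  assume lox: "loxodromic (inv x \<otimes> u \<otimes> x)"
  have u: "u \<in> carrier G" using uM by auto
  define C where "C = 3 * \<delta> + 1"
  have C: "0 \<le> C" using delta_nonneg by (simp add: C_def)
  have sq: "len (k \<otimes> k) \<le> len k + C" if "k \<in> M" for k
    using nolox[OF that] that by (auto simp: loxodromic_def C_def)
  have uk: "u [^] (n::int) \<in> M" for n using subgroup_int_pow_closed[OF M uM] .
  have growth: "len (u [^] (2 ^ k :: int)) \<le> len u + real k * C" for k :: nat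
  proof (induction k)
    case 0 then show ?case using u by simp
  next
    case (Suc k)
    have "u [^] (2 ^ Suc k :: int) = u [^] (2 ^ k :: int) \<otimes> u [^] (2 ^ k :: int)"
      using int_pow_mult[OF u, of "2^k" "2^k"] by simp
    then show ?case using Suc sq[OF uk[of "2^k"]] by (simp add: algebra_simps)
  qed
  define A where "A = 2 * len x + len u"
  have A: "0 \<le> A" using dst_nonneg u x by (simp add: A_def)
  \<comment> \<open>As \<open>2^(2j) \<ge> j\<^sup>2\<close>, this choice makes the exponential beat the bound \<open>A + 2jC\<close>.\<close>
  obtain j :: nat where j: "real j > A + 2 * C + 1" using reals_Archimedean2 by blast
  have j1: "1 \<le> real j" using j A C by linarith
  have "real j < 2 ^ j" by (rule of_nat_less_two_power)
  then have "real j * real j \<le> 2 ^ j * 2 ^ j" by (intro mult_mono) auto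
  also have "\<dots> = 2 ^ (2 * j)" by (simp add: power_add[symmetric] mult_2)
  also have "\<dots> \<le> len ((inv x \<otimes> u \<otimes> x) [^] (2 ^ (2 * j) :: int))"
    using loxodromic_len_pow_ge[OF lox, of "2 ^ (2 * j)"] by simp
  also have "\<dots> = len (inv x \<otimes> u [^] (2 ^ (2 * j) :: int) \<otimes> x)"
    using int_pow_conj[of "inv x" u "2 ^ (2 * j)"] x u by simp
  also have "\<dots> \<le> A + real (2 * j) * C"
    using len_mult_le[of "inv x \<otimes> u [^] (2 ^ (2 * j) :: int)" x] len_inv[OF x]
      len_mult_le[of "inv x" "u [^] (2 ^ (2 * j) :: int)"] growth[of "2 * j"] x u
    by (simp add: A_def)
  also have "\<dots> \<le> real j * A + real (2 * j) * C"
    using j1 A mult_right_mono[of 1 "real j" A] by simp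
  also have "\<dots> = real j * (A + 2 * C)" by (simp add: algebra_simps)
  also have "\<dots> < real j * real j" using j j1 by (intro mult_strict_left_mono) auto
  finally show False by simp
qed

text \<open>
  Let \<open>x\<close> be the point at distance \<open>s\<close> on a geodesic from \<open>1\<close> to a very long \<open>m\<close>. As \<open>m\<close> and \<open>um\<close> point in the
  same direction, \<open>u\<close> moves \<open>x\<close> nearly along that geodesic, by some amount \<open>t\<close>. The same direction
  shows that a second application of \<open>u\<close> moves it by the same amount the same way, so \<open>u\<^sup>2\<close> displaces \<open>x\<close>
  by about \<open>2t\<close>. If \<open>t\<close> were large, this would make the conjugate of \<open>u\<close> by \<open>x\<close> loxodromic. The point is
  that the bound depends on \<open>\<delta>\<close> only, not on the length of \<open>u\<close>.
\<close>

lemma small_displacement_if_no_loxodromic: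
  assumes M: "subgroup M G" and nolox: "\<And>g. g \<in> M \<Longrightarrow> \<not> loxodromic g"
    and uM: "u \<in> M" and mM: "m \<in> M" and x: "x \<in> carrier G"
    and s: "len x = s" "dst x m = len m - s"
    and u_small: "len u \<le> l" and s_large: "s \<ge> l + 2 * \<delta> + 1"
    and m_large: "len m \<ge> 4 * s + 5 * l + 12 * \<delta> + 3"
  shows "len (inv x \<otimes> u \<otimes> x) \<le> 17 * \<delta> + 1"
proof (rule ccontr)
  assume far: "\<not> ?thesis"
  interpret M: subgroup M G by (rule M)
  have car: "u \<in> carrier G" "m \<in> carrier G" "x \<in> carrier G" using uM mM x by auto
  have l: "0 \<le> l" using u_small dst_nonneg[of \<one> u] car by simp
  define a where "a = dst (u \<otimes> x) m"
  have um: "len (u \<otimes> m) \<le> len m + l" using len_mult_le[of u m] car u_small by simp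
  \<comment> \<open>The directions of \<open>m\<close> and \<open>um\<close> agree far beyond \<open>x\<close> and its images.\<close>
  have mum: "dst m (u \<otimes> m) \<le> len m + l + 7 * \<delta> + 1"
    using product_large_if_no_loxodromic[OF M nolox mM, of "u \<otimes> m"] uM mM um l by auto
  have d1: "dst u (u \<otimes> m) = len m" "dst u (u \<otimes> x) = s" "dst (u \<otimes> x) (u \<otimes> m) = len m - s"
    "dst (u \<otimes> m) (u \<otimes> x) = len m - s"
    using car s dst_sym[of m x] by (auto simp: dst_mult_right dst_left_mult)
  have d2: "dst (u \<otimes> (u \<otimes> x)) (u \<otimes> m) = a" using car by (simp add: dst_left_mult a_def)
  have d3: "dst (u \<otimes> x) (u \<otimes> (u \<otimes> x)) = dst x (u \<otimes> x)" using car by (simp add: dst_left_mult)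
  have a': "dst m (u \<otimes> x) = a" using car by (simp add: a_def dst_sym)
  have ux: "len (u \<otimes> x) \<ge> s - l"
    using dst_triangle[of u \<one> "u \<otimes> x"] dst_sym[of u \<one>] d1 car u_small by simp
  have ux': "len (u \<otimes> x) \<le> s + l" using len_mult_le[of u x] car s u_small by simp
  have a_large: "a \<ge> len m - s - l" using dst_triangle[of \<one> "u \<otimes> x" m] ux' car by (simp add: a_def)
  \<comment> \<open>The point \<open>ux\<close> is on a geodesic from \<open>u\<close> to \<open>um\<close>; replacing \<open>um\<close> by \<open>m\<close> and then \<open>u\<close> by \<open>1\<close>
    shows that it is nearly between \<open>1\<close> and \<open>m\<close>, as \<open>x\<close> is.\<close>
  have "dst u (u \<otimes> m) + dst m (u \<otimes> x)
      \<le> max (dst u m + dst (u \<otimes> m) (u \<otimes> x)) (dst u (u \<otimes> x) + dst (u \<otimes> m) m) + 2 * \<delta>"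
    by (rule four_point) (use car in auto)
  then have um_ge: "dst u m \<ge> a + s - 2 * \<delta>"
    using d1 a' mum dst_sym[of m "u \<otimes> m"] a_large m_large s_large car l delta_nonneg by simp
  have "dst u m + dst \<one> (u \<otimes> x) \<le> max (dst u \<one> + dst m (u \<otimes> x)) (dst u (u \<otimes> x) + dst m \<one>) + 2 * \<delta>"
    by (rule four_point) (use car in auto)
  then have ux_between: "len (u \<otimes> x) + a \<le> len m + 4 * \<delta>"
    using um_ge d1 a' dst_sym[of u \<one>] dst_sym[of m \<one>] u_small ux s_large l delta_nonneg car
    by simp
  have "dst x (u \<otimes> x) + dst \<one> m \<le> max (dst x \<one> + dst (u \<otimes> x) m) (dst x m + dst (u \<otimes> x) \<one>) + 2 * \<delta>"
    by (rule four_point) (use car in auto)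
  then have disp1: "dst x (u \<otimes> x) \<le> \<bar>a - dst x m\<bar> + 6 * \<delta>"
    using ux_between s dst_sym[of x \<one>] dst_sym[of "u \<otimes> x" \<one>] car delta_nonneg
    by (simp add: a_def)
  define t where "t = \<bar>a - dst x m\<bar>"
  have disp_le: "dst x (u \<otimes> x) \<le> 2 * s + l"
    using dst_triangle[of x \<one> "u \<otimes> x"] ux' s dst_sym[of x \<one>] car by simp
  have uux: "dst (u \<otimes> (u \<otimes> x)) m \<ge> len m - s - 2 * l"
    using dst_triangle[of \<one> "u \<otimes> (u \<otimes> x)" m] len_mult_le[of u "u \<otimes> x"] ux' u_small car by simp
  \<comment> \<open>As seen from \<open>ux\<close> and \<open>u\<^sup>2x\<close>, the points \<open>m\<close> and \<open>um\<close> are so far away in a common direction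
    that the difference of the distances to \<open>m\<close> is that of the distances to \<open>um\<close>, which by
    invariance is the difference for \<open>x\<close> and \<open>ux\<close> with respect to \<open>m\<close>.\<close>
  have "dst (u \<otimes> x) m + dst (u \<otimes> (u \<otimes> x)) (u \<otimes> m)
      \<le> max (dst (u \<otimes> x) (u \<otimes> (u \<otimes> x)) + dst m (u \<otimes> m))
          (dst (u \<otimes> x) (u \<otimes> m) + dst m (u \<otimes> (u \<otimes> x))) + 2 * \<delta>"
    by (rule four_point) (use car in auto)
  then have c1: "2 * a \<le> dst x m + dst (u \<otimes> (u \<otimes> x)) m + 2 * \<delta>"
    using d1 d2 d3 mum disp_le a_large m_large s s_large dst_sym[of m "u \<otimes> (u \<otimes> x)"] car l delta_nonneg
    by (simp add: a_def)
  have "dst (u \<otimes> x) (u \<otimes> m) + dst (u \<otimes> (u \<otimes> x)) m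
      \<le> max (dst (u \<otimes> x) (u \<otimes> (u \<otimes> x)) + dst (u \<otimes> m) m)
          (dst (u \<otimes> x) m + dst (u \<otimes> m) (u \<otimes> (u \<otimes> x))) + 2 * \<delta>"
    by (rule four_point) (use car in auto)
  then have c2: "dst x m + dst (u \<otimes> (u \<otimes> x)) m \<le> 2 * a + 2 * \<delta>"
    using d1 d2 d3 mum disp_le uux m_large s s_large dst_sym[of "u \<otimes> m" "u \<otimes> (u \<otimes> x)"]
      dst_sym[of m "u \<otimes> m"] car l delta_nonneg
    by (simp add: a_def)
  have "dst x (u \<otimes> (u \<otimes> x)) \<ge> \<bar>dst (u \<otimes> (u \<otimes> x)) m - dst x m\<bar>"
    using dst_triangle[of x "u \<otimes> (u \<otimes> x)" m] dst_triangle[of "u \<otimes> (u \<otimes> x)" x m]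
      dst_sym[of x "u \<otimes> (u \<otimes> x)"] car by simp
  then have disp2: "dst x (u \<otimes> (u \<otimes> x)) \<ge> 2 * t - 2 * \<delta>"
    using c1 c2 unfolding t_def by (auto simp: abs_if split: if_splits)
  define g where "g = inv x \<otimes> u \<otimes> x"
  have g: "g \<in> carrier G" using car by (simp add: g_def)
  have lg: "len g = dst x (u \<otimes> x)" using car dst_eq_len[of x "u \<otimes> x"] by (simp add: g_def m_assoc)
  have "g \<otimes> g = inv x \<otimes> (u \<otimes> (x \<otimes> inv x) \<otimes> (u \<otimes> x))" using car by (simp add: g_def m_assoc)
  then have "len (g \<otimes> g) = dst x (u \<otimes> (u \<otimes> x))" using car dst_eq_len[of x "u \<otimes> (u \<otimes> x)"] by simp
  then have "loxodromic g"
    using g lg far disp1 disp2 unfolding loxodromic_def g_def[symmetric] t_def[symmetric] by linarith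
  then show False using conj_not_loxodromic[OF M nolox uM x] by (simp add: g_def)
qed

text \<open>
  Without loxodromic elements, any finite set \<open>U\<close> of elements moves a suitable point \<open>x\<close> by a bounded
  amount, with a bound that depends on \<open>\<delta>\<close> only. By left invariance, conjugation by \<open>x\<close> maps \<open>U\<close> injectively
  into a fixed ball around the identity, which bounds the size of \<open>U\<close>. Here it matters that \<open>x\<close> can
  be any point and still be an element of the group: groups of parabolic isometries act properly on
  hyperbolic spaces, but they contain no loxodromic elements.
\<close>

lemma infinite_subgroup_has_loxodromic:
  assumes M: "subgroup M G" and inf: "infinite M"
  shows "\<exists>g\<in>M. loxodromic g"
proof (rule ccontr)
  assume "\<not> ?thesis"
  then have nolox: "\<And>g. g \<in> M \<Longrightarrow> \<not> loxodromic g" by blast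
  interpret M: subgroup M G by (rule M)
  define B where "B = {g \<in> carrier G. len g \<le> 17 * \<delta> + 1}"
  have finB: "finite B" unfolding B_def by (rule finite_ball)
  obtain U where U: "finite U" "U \<subseteq> M" "card U = Suc (card B)"
    using infinite_arbitrarily_large[OF inf] by blast
  have "U \<noteq> {}" using U by auto
  define l where "l = Max (len ` U)"
  have l: "len u \<le> l" if "u \<in> U" for u using U that by (auto simp: l_def)
  have l0: "0 \<le> l"
  proof -
    obtain u where u: "u \<in> U" using \<open>U \<noteq> {}\<close> by blast
    then have "u \<in> carrier G" using U(2) by auto
    then show ?thesis using l[OF u] dst_nonneg[of \<one> u] by simp
  qed
  define s where "s = nat \<lceil>l + 2 * \<delta> + 1\<rceil>"
  have s: "real s \<ge> l + 2 * \<delta> + 1" unfolding s_def by linarith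
  define R where "R = 4 * real s + 5 * l + 12 * \<delta> + 3"
  have "\<not> M \<subseteq> {g \<in> carrier G. len g \<le> R}" using inf finite_ball[of R] finite_subset by blast
  then obtain m where mM: "m \<in> M" and m: "len m \<ge> R" by fastforce
  have "real s \<le> len m" using m l0 delta_nonneg by (simp add: R_def)
  then obtain x where x: "x \<in> carrier G" "len x = real s" "dst x m = len m - real s"
    using geodesic_point[of m s] mM by auto
  have "inv x \<otimes> u \<otimes> x \<in> B" if "u \<in> U" for u
    using small_displacement_if_no_loxodromic[OF M nolox, of u m x s l] U that mM x l[OF that] s m
    by (auto simp: B_def R_def)
  moreover have "inj_on (\<lambda>u. inv x \<otimes> u \<otimes> x) U"
    using U(2) x(1) by (intro inj_onI) (auto simp: subset_iff)
  ultimately have "card U \<le> card B" using finB by (intro card_inj_on_le[of "\<lambda>u. inv x \<otimes> u \<otimes> x"]) auto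
  then show False using U by simp
qed

end

section \<open>Infinite normal subgroups and elements with finitely many conjugates\<close>

text \<open>
  The form in which virtual cyclicity is obtained below.
\<close>

lemma (in group) elementary_if_covered_by_powers:
  assumes m: "m \<in> carrier G" and B: "finite B" "B \<subseteq> carrier G"
    and cover: "\<And>x. x \<in> carrier G \<Longrightarrow> \<exists>i::int. \<exists>b\<in>B. x = m [^] i \<otimes> b"
  shows "elementary_group G"
proof -
  define H where "H = carrier (subgroup_generated G {m})"
  have H: "H = range (\<lambda>n::int. m [^] n)"
    unfolding H_def using m by (rule carrier_subgroup_generated_by_singleton)
  have sub: "subgroup H G" unfolding H_def by (rule subgroup_subgroup_generated)
  have cyc: "cyclic_group (G\<lparr>carrier := H\<rparr>)"
    using cyclic_group_generated[of m] by (simp add: H_def subgroup_generated_def)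
  have "rcosets H \<subseteq> (\<lambda>b. H #> b) ` B"
  proof
    fix C assume "C \<in> rcosets H"
    then obtain x where x: "x \<in> carrier G" "C = H #> x" by (auto simp: RCOSETS_def)
    then obtain i :: int and b where b: "b \<in> B" "x = m [^] i \<otimes> b" using cover by blast
    have "x \<in> H #> b" using b by (auto simp: r_coset_def H)
    then have "H #> b = H #> x" using b B sub by (intro repr_independence) auto
    then show "C \<in> (\<lambda>b. H #> b) ` B" using b x by auto
  qed
  then have "finite (rcosets H)" by (rule finite_subset) (use B in simp)
  then show ?thesis unfolding elementary_group_def using sub cyc by blast
qed

definition fc_center :: "('g, 'b) monoid_scheme \<Rightarrow> 'g set" where
  "fc_center G = {x \<in> carrier G. finite ((\<lambda>g. inv\<^bsub>G\<^esub> g \<otimes>\<^bsub>G\<^esub> x \<otimes>\<^bsub>G\<^esub> g) ` carrier G)}"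

lemma (in group) subgroup_fc_center: "subgroup (fc_center G) G"
proof
  show "fc_center G \<subseteq> carrier G" by (auto simp: fc_center_def)
  have "(\<lambda>g. inv g \<otimes> \<one> \<otimes> g) ` carrier G \<subseteq> {\<one>}" by auto
  then have "finite ((\<lambda>g. inv g \<otimes> \<one> \<otimes> g) ` carrier G)" by (rule finite_subset) simp
  then show "\<one> \<in> fc_center G" by (simp add: fc_center_def)
next
  fix x y assume "x \<in> fc_center G" "y \<in> fc_center G"
  then have xy: "x \<in> carrier G" "y \<in> carrier G"
    and fin: "finite ((\<lambda>g. inv g \<otimes> x \<otimes> g) ` carrier G)" "finite ((\<lambda>g. inv g \<otimes> y \<otimes> g) ` carrier G)"
    by (auto simp: fc_center_def)
  have "(\<lambda>g. inv g \<otimes> (x \<otimes> y) \<otimes> g) ` carrier G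
      \<subseteq> (\<lambda>(a, b). a \<otimes> b) ` (((\<lambda>g. inv g \<otimes> x \<otimes> g) ` carrier G) \<times> ((\<lambda>g. inv g \<otimes> y \<otimes> g) ` carrier G))"
  proof clarsimp
    fix g assume g: "g \<in> carrier G"
    have "inv g \<otimes> (x \<otimes> y) \<otimes> g = inv g \<otimes> x \<otimes> g \<otimes> (inv g \<otimes> y \<otimes> g)"
      using g xy by (simp add: m_assoc)
    then show "inv g \<otimes> (x \<otimes> y) \<otimes> g \<in> (\<lambda>(a, b). a \<otimes> b) `
        ((\<lambda>g. inv g \<otimes> x \<otimes> g) ` carrier G \<times> (\<lambda>g. inv g \<otimes> y \<otimes> g) ` carrier G)"
      using g by (intro image_eqI[of _ _ "(inv g \<otimes> x \<otimes> g, inv g \<otimes> y \<otimes> g)"]) auto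
  qed
  then have "finite ((\<lambda>g. inv g \<otimes> (x \<otimes> y) \<otimes> g) ` carrier G)"
    by (rule finite_subset) (use fin in simp)
  then show "x \<otimes> y \<in> fc_center G" using xy by (simp add: fc_center_def)
next
  fix x assume "x \<in> fc_center G"
  then have x: "x \<in> carrier G" and fin: "finite ((\<lambda>g. inv g \<otimes> x \<otimes> g) ` carrier G)"
    by (auto simp: fc_center_def)
  have "(\<lambda>g. inv g \<otimes> inv x \<otimes> g) ` carrier G = (\<lambda>y. inv y) ` (\<lambda>g. inv g \<otimes> x \<otimes> g) ` carrier G"
    unfolding image_image by (rule image_cong) (use x in \<open>auto simp: inv_mult_group m_assoc\<close>)
  then show "inv x \<in> fc_center G" using fin x by (simp add: fc_center_def)
qed

text \<open>
  Conjugation by \<open>K\<close> stays inside \<open>H\<close>, so the conjugates of \<open>x\<close> are among those of the finitely many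
  elements of \<open>H\<close> by the finitely many elements of \<open>T\<close>.
\<close>

lemma (in group) finite_normalized_subset_fc_center:
  assumes K: "subgroup K G" and T: "finite T" "T \<subseteq> carrier G"
    and cover: "\<And>g. g \<in> carrier G \<Longrightarrow> \<exists>k\<in>K. \<exists>t\<in>T. g = k \<otimes> t"
    and H: "finite H" "H \<subseteq> carrier G" and norm: "\<And>k x. \<lbrakk>k \<in> K; x \<in> H\<rbrakk> \<Longrightarrow> k \<otimes> x \<otimes> inv k \<in> H"
  shows "H \<subseteq> fc_center G"
proof
  fix x assume x: "x \<in> H"
  have "(\<lambda>g. inv g \<otimes> x \<otimes> g) ` carrier G \<subseteq> (\<lambda>(t, y). inv t \<otimes> y \<otimes> t) ` (T \<times> H)"
  proof clarify
    fix g assume "g \<in> carrier G"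
    then obtain k t where kt: "k \<in> K" "t \<in> T" "g = k \<otimes> t" using cover by blast
    have car: "k \<in> carrier G" "t \<in> carrier G" "x \<in> carrier G"
      using kt T H x subgroup.mem_carrier[OF K] by auto
    have "inv k \<otimes> x \<otimes> k \<in> H"
      using norm[of "inv k" x] x kt subgroup.m_inv_closed[OF K] car by simp
    moreover have "inv g \<otimes> x \<otimes> g = inv t \<otimes> (inv k \<otimes> x \<otimes> k) \<otimes> t"
      using kt car by (simp add: inv_mult_group m_assoc)
    ultimately show "inv g \<otimes> x \<otimes> g \<in> (\<lambda>(t, y). inv t \<otimes> y \<otimes> t) ` (T \<times> H)"
      using kt by (intro image_eqI[of _ _ "(t, inv k \<otimes> x \<otimes> k)"]) auto
  qed
  moreover have "finite ((\<lambda>(t, y). inv t \<otimes> y \<otimes> t) ` (T \<times> H))" using T H by simp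
  ultimately have "finite ((\<lambda>g. inv g \<otimes> x \<otimes> g) ` carrier G)" by (rule finite_subset)
  then show "x \<in> fc_center G" using x H by (auto simp: fc_center_def)
qed

context hyperbolic_metric_group
begin

text \<open>
  The bound in \<open>commensurator_close_to_axis\<close> and the finiteness of balls give a cover by finitely many cosets.
\<close>

lemma commensurator_covered_by_powers:
  assumes lox: "loxodromic g"
  obtains B where "finite B" "B \<subseteq> carrier G"
    "\<And>x a b. \<lbrakk>x \<in> carrier G; (a::int) \<noteq> 0; x \<otimes> g [^] a = g [^] (b::int) \<otimes> x\<rbrakk>
      \<Longrightarrow> \<exists>i::int. \<exists>c\<in>B. x = g [^] i \<otimes> c"
proof
  have g: "g \<in> carrier G" using lox by (simp add: loxodromic_def)
  define B where "B = {c \<in> carrier G. len c \<le> 2 * len g + 10 * \<delta>}"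
  show "finite B" unfolding B_def by (rule finite_ball)
  show "B \<subseteq> carrier G" by (auto simp: B_def)
  fix x and a b :: int
  assume x: "x \<in> carrier G" and "a \<noteq> 0" "x \<otimes> g [^] a = g [^] b \<otimes> x"
  then obtain i :: int where i: "dst x (g [^] i) \<le> 2 * len g + 10 * \<delta>"
    using commensurator_close_to_axis[OF lox] by blast
  define c where "c = inv (g [^] i) \<otimes> x"
  have "len c = dst x (g [^] i)"
    using x g dst_eq_len[of "g [^] i" x] dst_sym[of x "g [^] i"] by (simp add: c_def)
  then have "c \<in> B" using i x g by (simp add: B_def c_def)
  moreover have "x = g [^] i \<otimes> c" using x g by (simp add: c_def m_assoc[symmetric])
  ultimately show "\<exists>i::int. \<exists>c\<in>B. x = g [^] i \<otimes> c" by blast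
qed

text \<open>
  An infinite FC-center contains a loxodromic \<open>z\<close>. Two elements that conjugate \<open>z\<close> to the same element differ by
  an element of its centralizer, which is covered by finitely many cosets of the powers of \<open>z\<close>.
\<close>

lemma finite_fc_center:
  assumes nonel: "\<not> elementary_group G"
  shows "finite (fc_center G)"
proof (rule ccontr)
  assume "infinite (fc_center G)"
  then obtain z where z: "z \<in> fc_center G" "loxodromic z"
    using infinite_subgroup_has_loxodromic[OF subgroup_fc_center] by blast
  have zG: "z \<in> carrier G" using z by (simp add: loxodromic_def)
  obtain B where B: "finite B" "B \<subseteq> carrier G"
    "\<And>x a b. \<lbrakk>x \<in> carrier G; (a::int) \<noteq> 0; x \<otimes> z [^] a = z [^] (b::int) \<otimes> x\<rbrakk>
      \<Longrightarrow> \<exists>i::int. \<exists>c\<in>B. x = z [^] i \<otimes> c"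
    using commensurator_covered_by_powers[OF z(2)] by blast
  let ?f = "\<lambda>g. inv g \<otimes> z \<otimes> g"
  have "finite (?f ` carrier G)" using z by (simp add: fc_center_def)
  then obtain T where T: "T \<subseteq> carrier G" "finite T" "?f ` carrier G = ?f ` T"
    using finite_subset_image[of "?f ` carrier G" ?f "carrier G"] by auto
  have "elementary_group G"
  proof (rule elementary_if_covered_by_powers[OF zG, of "(\<lambda>(c, t). c \<otimes> t) ` (B \<times> T)"])
    show "finite ((\<lambda>(c, t). c \<otimes> t) ` (B \<times> T))" using B T by simp
    show "(\<lambda>(c, t). c \<otimes> t) ` (B \<times> T) \<subseteq> carrier G" using B T by auto
    fix g assume g: "g \<in> carrier G"
    then have "?f g \<in> ?f ` T" using T(3) by blast
    then obtain t where t: "t \<in> T" "?f g = ?f t" by blast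
    then have tG: "t \<in> carrier G" using T by auto
    have "g \<otimes> inv t \<otimes> z = g \<otimes> (inv t \<otimes> z \<otimes> t) \<otimes> inv t" using g tG zG by (simp add: m_assoc)
    also have "\<dots> = z \<otimes> (g \<otimes> inv t)" unfolding t(2)[symmetric]
      using g tG zG by (simp add: m_assoc[symmetric])
    finally have "\<exists>i::int. \<exists>c\<in>B. g \<otimes> inv t = z [^] i \<otimes> c"
      using B(3)[of "g \<otimes> inv t" 1 1] g tG zG by simp
    then obtain i :: int and c where ic: "c \<in> B" "g \<otimes> inv t = z [^] i \<otimes> c" by blast
    then have "g = z [^] i \<otimes> (c \<otimes> t)"
    proof -
      have "c \<in> carrier G" using ic B(2) by auto
      moreover have "g = z [^] i \<otimes> c \<otimes> t" unfolding ic(2)[symmetric] using g tG by (simp add: m_assoc)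
      ultimately show ?thesis using zG tG by (simp add: m_assoc)
    qed
    then show "\<exists>i::int. \<exists>b\<in>(\<lambda>(c, t). c \<otimes> t) ` (B \<times> T). g = z [^] i \<otimes> b"
      using ic t by (intro exI[of _ i] bexI[of _ "c \<otimes> t"]) auto
  qed
  then show False using nonel by simp
qed

text \<open>
  If the intersection were finite, the powers of a loxodromic \<open>m\<close> in \<open>M\<close> would have only finitely many
  commutators with an element of \<open>N\<close>, and the whole group would end up commensurating the powers of \<open>m\<close>.
\<close>

lemma infinite_Int_normal:
  assumes nonel: "\<not> elementary_group G"
    and K: "subgroup K G" and T: "finite T" "T \<subseteq> carrier G"
    and cover: "\<And>g. g \<in> carrier G \<Longrightarrow> \<exists>k\<in>K. \<exists>t\<in>T. g = k \<otimes> t"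
    and N: "subgroup N G" "N \<subseteq> K" "infinite N" "\<And>k x. \<lbrakk>k \<in> K; x \<in> N\<rbrakk> \<Longrightarrow> k \<otimes> x \<otimes> inv k \<in> N"
    and M: "subgroup M G" "M \<subseteq> K" "infinite M" "\<And>k x. \<lbrakk>k \<in> K; x \<in> M\<rbrakk> \<Longrightarrow> k \<otimes> x \<otimes> inv k \<in> M"
  shows "infinite (N \<inter> M)"
proof
  assume fin: "finite (N \<inter> M)"
  interpret K: subgroup K G by (rule K)
  interpret N: subgroup N G by (rule N)
  interpret M: subgroup M G by (rule M)
  obtain m where m: "m \<in> M" "loxodromic m" using infinite_subgroup_has_loxodromic[OF M(1,3)] by blast
  obtain n where n: "n \<in> N" "loxodromic n" using infinite_subgroup_has_loxodromic[OF N(1,3)] by blast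
  have mG: "m \<in> carrier G" and nG: "n \<in> carrier G" using m n by auto
  obtain B where B: "finite B" "B \<subseteq> carrier G"
    "\<And>x a b. \<lbrakk>x \<in> carrier G; (a::int) \<noteq> 0; x \<otimes> m [^] a = m [^] (b::int) \<otimes> x\<rbrakk>
      \<Longrightarrow> \<exists>i::int. \<exists>c\<in>B. x = m [^] i \<otimes> c"
    using commensurator_covered_by_powers[OF m(2)] by blast
  \<comment> \<open>Two powers of \<open>m\<close> have the same commutator with \<open>x\<close>, so \<open>x\<close> commutes with their quotient.\<close>
  have N_cover: "\<exists>i::int. \<exists>c\<in>B. x = m [^] i \<otimes> c" if x: "x \<in> N" for x
  proof -
    have xG: "x \<in> carrier G" using x by auto
    define c where "c = (\<lambda>i::int. m [^] i \<otimes> x \<otimes> inv (m [^] i) \<otimes> inv x)"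
    have "range c \<subseteq> N \<inter> M"
    proof clarify
      fix i :: int
      have mi: "m [^] i \<in> M" using subgroup_int_pow_closed[OF M(1) m(1)] .
      have "m [^] i \<otimes> x \<otimes> inv (m [^] i) \<in> N" using N(4) mi M(2) x by blast
      then have "m [^] i \<otimes> x \<otimes> inv (m [^] i) \<otimes> inv x \<in> N" using x by blast
      moreover have "x \<otimes> inv (m [^] i) \<otimes> inv x \<in> M" using M(4) mi N(2) x by blast
      then have "m [^] i \<otimes> (x \<otimes> inv (m [^] i) \<otimes> inv x) \<in> M" using mi by blast
      ultimately show "c i \<in> N \<inter> M" using x xG mG by (auto simp: c_def m_assoc)
    qed
    then have "finite (range c)" using fin by (rule finite_subset)
    then have "\<not> inj c" using finite_imageD infinite_UNIV_int by blast
    then obtain i j where ij: "i \<noteq> j" "c i = c j" by (auto simp: inj_def)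
    define a b where "a = m [^] i" and "b = m [^] j"
    have ab: "a \<in> carrier G" "b \<in> carrier G" using mG by (auto simp: a_def b_def)
    have "a \<otimes> x \<otimes> inv a = b \<otimes> x \<otimes> inv b"
      using ij(2) xG ab unfolding c_def a_def[symmetric] b_def[symmetric] by simp
    then have eq: "inv a \<otimes> (a \<otimes> x \<otimes> inv a) \<otimes> b = inv a \<otimes> (b \<otimes> x \<otimes> inv b) \<otimes> b" by simp
    have ji: "m [^] (j - i) = inv a \<otimes> b"
      using int_pow_mult[OF mG, of "- i" j] int_pow_neg[OF mG, of i] by (simp add: a_def b_def)
    have "x \<otimes> m [^] (j - i) = m [^] (j - i) \<otimes> x"
      unfolding ji using eq xG ab by (simp add: m_assoc)
    then show ?thesis using B(3)[OF xG, of "j - i" "j - i"] ij by simp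
  qed
  \<comment> \<open>Among the powers of \<open>x\<close>, two lie in the same coset of the powers of \<open>m\<close>.\<close>
  have power_in: "\<exists>(p::int) (q::int). p \<noteq> 0 \<and> x [^] p = m [^] q" if x: "x \<in> N" for x
  proof -
    have xG: "x \<in> carrier G" using x by auto
    have "\<forall>i::int. \<exists>s::int. \<exists>c\<in>B. x [^] i = m [^] s \<otimes> c"
      using N_cover subgroup_int_pow_closed[OF N(1) x] by blast
    then obtain s c where sc: "\<And>i::int. c i \<in> B" "\<And>i::int. x [^] i = m [^] (s i :: int) \<otimes> c i" by metis
    have "range c \<subseteq> B" using sc(1) by blast
    then have "finite (range c)" using B(1) by (rule finite_subset)
    then have "\<not> inj c" using finite_imageD infinite_UNIV_int by blast
    then obtain i j where ij: "i \<noteq> j" "c i = c j" by (auto simp: inj_def)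
    have cG: "c j \<in> carrier G" using sc B by auto
    have "x [^] (i - j) = x [^] i \<otimes> inv (x [^] j)" using xG by (simp add: int_pow_diff)
    also have "\<dots> = m [^] (s i) \<otimes> c j \<otimes> (inv (c j) \<otimes> inv (m [^] (s j)))"
      using ij sc(2)[of i] sc(2)[of j] cG mG by (simp add: inv_mult_group)
    also have "\<dots> = m [^] (s i - s j)" using cG mG by (simp add: int_pow_diff m_assoc)
    finally have "x [^] (i - j) = m [^] (s i - s j)" .
    moreover have "i - j \<noteq> 0" using ij by simp
    ultimately show ?thesis by (intro exI[of _ "i - j"] exI[of _ "s i - s j"] conjI)
  qed
  obtain p q :: int where pq: "p \<noteq> 0" "n [^] p = m [^] q" using power_in[OF n(1)] by blast
  have q: "q \<noteq> 0" using loxodromic_pow_inj[OF n(2), of p 0] pq nG by auto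
  \<comment> \<open>Both \<open>n\<close> and its conjugate by \<open>k\<close> have a power in common with \<open>m\<close>, so \<open>k\<close> commensurates the
    powers of \<open>m\<close>.\<close>
  have K_cover: "\<exists>i::int. \<exists>c\<in>B. k = m [^] i \<otimes> c" if k: "k \<in> K" for k
  proof -
    have kG: "k \<in> carrier G" using k by auto
    obtain p' q' :: int where pq': "p' \<noteq> 0" "(k \<otimes> n \<otimes> inv k) [^] p' = m [^] q'"
      using power_in[OF N(4)[OF k n(1)]] by blast
    have "m [^] (q' * p) = (k \<otimes> n \<otimes> inv k) [^] (p' * p)"
      using pq'(2) mG kG nG by (simp add: int_pow_pow[symmetric])
    also have "\<dots> = k \<otimes> n [^] (p' * p) \<otimes> inv k" using kG nG by (rule int_pow_conj)
    also have "n [^] (p' * p) = m [^] (q * p')"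
      using pq(2) nG mG by (metis int_pow_pow mult.commute)
    finally have "k \<otimes> m [^] (q * p') = m [^] (q' * p) \<otimes> k" using kG mG by (simp add: m_assoc)
    moreover have "q * p' \<noteq> 0" using q pq' by simp
    ultimately show ?thesis by (intro B(3)[OF kG])
  qed
  have "elementary_group G"
  proof (rule elementary_if_covered_by_powers[OF mG, of "(\<lambda>(c, t). c \<otimes> t) ` (B \<times> T)"])
    show "finite ((\<lambda>(c, t). c \<otimes> t) ` (B \<times> T))" using B T by simp
    show "(\<lambda>(c, t). c \<otimes> t) ` (B \<times> T) \<subseteq> carrier G" using B T by auto
    fix g assume "g \<in> carrier G"
    then obtain k t where kt: "k \<in> K" "t \<in> T" "g = k \<otimes> t" using cover by blast
    obtain i :: int and c where ic: "c \<in> B" "k = m [^] i \<otimes> c" using K_cover[OF kt(1)] by blast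
    have "c \<in> carrier G" "t \<in> carrier G" using ic kt B T by auto
    then have "g = m [^] i \<otimes> (c \<otimes> t)" using kt ic mG by (simp add: m_assoc)
    then show "\<exists>i::int. \<exists>b\<in>(\<lambda>(c, t). c \<otimes> t) ` (B \<times> T). g = m [^] i \<otimes> b"
      using ic kt by (intro exI[of _ i] bexI[of _ "c \<otimes> t"]) auto
  qed
  then show False using nonel by simp
qed

end

section \<open>Stabilizers in the rooted tree\<close>

context rooted_tree_action
begin

sublocale group G
  using group_hom by (rule group_hom.axioms(1))

sublocale connected_undirected_graph V E
  using tree by unfold_locales (auto simp: tree_graph_def simple_graph_def)

lemma act_closed: "\<lbrakk>g \<in> carrier G; v \<in> V\<rbrakk> \<Longrightarrow> \<phi> g v \<in> V"
  using element_image by blast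

lemma act_one: "v \<in> V \<Longrightarrow> \<phi> \<one> v = v"
  using id_eq_one by (metis restrict_apply')

lemma act_inv:
  assumes "g \<in> carrier G" "v \<in> V"
  shows "\<phi> (inv g) (\<phi> g v) = v" "\<phi> g (\<phi> (inv g) v) = v"
  using composition_rule[of v "inv g" g] composition_rule[of v g "inv g"] act_one assms by auto

lemma act_conj:
  assumes "g \<in> carrier G" "h \<in> carrier G" "v \<in> V"
  shows "\<phi> (g \<otimes> h \<otimes> inv g) v = \<phi> g (\<phi> h (\<phi> (inv g) v))"
  using assms by (simp add: composition_rule act_closed)

lemma act_edges: "\<lbrakk>g \<in> carrier G; u \<in> V; v \<in> V; (u, v) \<in> E\<rbrakk> \<Longrightarrow> (\<phi> g u, \<phi> g v) \<in> E"
  using adj_iff by blast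

lemma graph_dist_act:
  assumes g: "g \<in> carrier G" and v: "v \<in> V"
  shows "graph_dist V E r (\<phi> g v) = graph_dist V E r v"
proof (rule antisym)
  have le: "graph_dist V E r (\<phi> h w) \<le> graph_dist V E r w" if "h \<in> carrier G" "w \<in> V" for h w
    using graph_dist_map_le[OF root_in_V that(2), of "\<phi> h"] that act_closed act_edges fixes_root
    by simp
  show "graph_dist V E r (\<phi> g v) \<le> graph_dist V E r v" using le g v .
  show "graph_dist V E r v \<le> graph_dist V E r (\<phi> g v)"
    using le[of "inv g" "\<phi> g v"] act_inv(1)[OF g v] act_closed[OF g v] g by simp
qed

lemma descendants_act:
  assumes g: "g \<in> carrier G" and w: "w \<in> descendants V E r v"
  shows "\<phi> g w \<in> descendants V E r (\<phi> g v)"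
proof -
  obtain p where p: "w \<in> V" "walk_betw V E r p w" "length p = Suc (graph_dist V E r w)" "v \<in> set p"
    using w by (auto simp: descendants_def geodesic_betw_def)
  have "walk_betw V E (\<phi> g r) (map (\<phi> g) p) (\<phi> g w)"
    using p(2) g act_closed act_edges by (intro walk_betw_map) auto
  then have "geodesic_betw V E r (map (\<phi> g) p) (\<phi> g w)"
    using p g by (simp add: geodesic_betw_def fixes_root graph_dist_act)
  moreover have "\<phi> g v \<in> set (map (\<phi> g) p)" using p(4) by simp
  ultimately show ?thesis using act_closed[OF g p(1)] unfolding descendants_def by blast
qed

lemma descendants_subset: "descendants V E r v \<subseteq> V"
  by (auto simp: descendants_def)

lemma subgroup_pointwise_stabilizer:
  assumes "A \<subseteq> V"
  shows "subgroup {g \<in> carrier G. \<forall>x\<in>A. \<phi> g x = x} G"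
proof
  show "\<one> \<in> {g \<in> carrier G. \<forall>x\<in>A. \<phi> g x = x}" using assms act_one by auto
  fix g assume g: "g \<in> {g \<in> carrier G. \<forall>x\<in>A. \<phi> g x = x}"
  have "\<phi> (inv g) x = x" if "x \<in> A" for x
    using act_inv(1)[of g x] g that assms by auto
  then show "inv g \<in> {g \<in> carrier G. \<forall>x\<in>A. \<phi> g x = x}" using g by auto
next
  fix g h assume "g \<in> {g \<in> carrier G. \<forall>x\<in>A. \<phi> g x = x}" "h \<in> {g \<in> carrier G. \<forall>x\<in>A. \<phi> g x = x}"
  then show "g \<otimes> h \<in> {g \<in> carrier G. \<forall>x\<in>A. \<phi> g x = x}"
    using assms composition_rule by (auto simp: subset_iff)
qed auto

lemma subgroup_subtree_stabilizer: "subgroup (subtree_stabilizer G V E r \<phi> v) G"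
  unfolding subtree_stabilizer_def by (rule subgroup_pointwise_stabilizer[OF descendants_subset])

lemma subtree_stabilizer_conj:
  assumes g: "g \<in> carrier G" and v: "v \<in> V" and h: "h \<in> subtree_stabilizer G V E r \<phi> v"
  shows "g \<otimes> h \<otimes> inv g \<in> subtree_stabilizer G V E r \<phi> (\<phi> g v)"
proof -
  have hG: "h \<in> carrier G" using h by (simp add: subtree_stabilizer_def)
  have "\<phi> (g \<otimes> h \<otimes> inv g) x = x" if x: "x \<in> descendants V E r (\<phi> g v)" for x
  proof -
    have xV: "x \<in> V" using x descendants_subset by blast
    have "\<phi> (inv g) x \<in> descendants V E r v"
      using descendants_act[OF _ x, of "inv g"] act_inv(1)[OF g v] g by simp
    then have "\<phi> h (\<phi> (inv g) x) = \<phi> (inv g) x" using h by (simp add: subtree_stabilizer_def)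
    then show ?thesis using act_conj[OF g hG xV] act_inv(2)[OF g xV] by simp
  qed
  then show ?thesis using g hG by (simp add: subtree_stabilizer_def)
qed

definition tree_ball :: "nat \<Rightarrow> 'v set" where
  "tree_ball n = {v \<in> V. graph_dist V E r v \<le> n}"

text \<open>
  Working with the stabilizer of a ball instead of that of a level makes it evident that an element
  fixing the subtrees below all vertices of the level fixes the vertices above the level, too.
\<close>

definition ball_stabilizer :: "nat \<Rightarrow> 'g set" where
  "ball_stabilizer n = {g \<in> carrier G. \<forall>v\<in>tree_ball n. \<phi> g v = v}"

lemma finite_tree_ball: "finite (tree_ball n)"
  unfolding tree_ball_def
proof (rule finite_graph_ball[OF _ root_in_V])
  fix v assume v: "v \<in> V"
  have "card (E `` {v}) \<noteq> 0"
  proof (cases "graph_dist V E r v = 0")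
    case True
    obtain p where "walk_betw V E r p v" "length p = Suc (graph_dist V E r v)"
      using geodesic_obtain[OF root_in_V v] by blast
    then have "v = r" using True by (auto simp: walk_betw_def length_Suc_conv)
    then show ?thesis using degree_root d_ge_2[of 0] by simp
  next
    case False
    then show ?thesis using degree[OF _ v refl] by simp
  qed
  then show "finite (E `` {v})" by (rule contrapos_np) simp
qed

lemma subgroup_ball_stabilizer: "subgroup (ball_stabilizer n) G"
  unfolding ball_stabilizer_def by (rule subgroup_pointwise_stabilizer) (auto simp: tree_ball_def)

lemma ball_stabilizer_conj:
  assumes g: "g \<in> carrier G" and h: "h \<in> ball_stabilizer n"
  shows "g \<otimes> h \<otimes> inv g \<in> ball_stabilizer n"
proof -
  have hG: "h \<in> carrier G" using h by (simp add: ball_stabilizer_def)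
  have "\<phi> (g \<otimes> h \<otimes> inv g) x = x" if x: "x \<in> tree_ball n" for x
  proof -
    have xV: "x \<in> V" using x by (simp add: tree_ball_def)
    have "\<phi> (inv g) x \<in> tree_ball n"
      using x g by (simp add: tree_ball_def act_closed graph_dist_act)
    then have "\<phi> h (\<phi> (inv g) x) = \<phi> (inv g) x" using h by (simp add: ball_stabilizer_def)
    then show ?thesis using act_conj[OF g hG xV] act_inv(2)[OF g xV] by simp
  qed
  then show ?thesis using g hG by (simp add: ball_stabilizer_def)
qed

lemma finite_ball_actions: "finite ((\<lambda>g. restrict (\<phi> g) (tree_ball n)) ` carrier G)"
proof (rule finite_subset)
  show "(\<lambda>g. restrict (\<phi> g) (tree_ball n)) ` carrier G \<subseteq> tree_ball n \<rightarrow>\<^sub>E tree_ball n"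
  proof clarify
    fix g assume g: "g \<in> carrier G"
    then have "\<phi> g v \<in> tree_ball n" if "v \<in> tree_ball n" for v
      using that by (simp add: tree_ball_def act_closed graph_dist_act)
    then show "restrict (\<phi> g) (tree_ball n) \<in> tree_ball n \<rightarrow>\<^sub>E tree_ball n" by auto
  qed
  show "finite (tree_ball n \<rightarrow>\<^sub>E tree_ball n)" by (intro finite_PiE finite_tree_ball)
qed

lemma same_ball_action_imp_stabilizer:
  assumes "g \<in> carrier G" "h \<in> carrier G" "restrict (\<phi> g) (tree_ball n) = restrict (\<phi> h) (tree_ball n)"
  shows "g \<otimes> inv h \<in> ball_stabilizer n"
proof -
  have "\<phi> (g \<otimes> inv h) v = v" if v: "v \<in> tree_ball n" for v
  proof -
    have vV: "v \<in> V" using v by (simp add: tree_ball_def)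
    have "\<phi> (inv h) v \<in> tree_ball n"
      using v assms(2) by (simp add: tree_ball_def act_closed graph_dist_act)
    then have "\<phi> g (\<phi> (inv h) v) = \<phi> h (\<phi> (inv h) v)" using assms(3) by (metis restrict_apply')
    then show ?thesis using act_inv(2)[OF assms(2) vV] composition_rule[OF vV, of g "inv h"] assms by simp
  qed
  then show ?thesis using assms by (simp add: ball_stabilizer_def)
qed

text \<open>
  The finite index of the ball stabilizer, in the form that the results on hyperbolic groups use.
\<close>

lemma ball_stabilizer_cover:
  obtains T where "finite T" "T \<subseteq> carrier G"
    "\<And>g. g \<in> carrier G \<Longrightarrow> \<exists>k\<in>ball_stabilizer n. \<exists>t\<in>T. g = k \<otimes> t"
proof -
  let ?f = "\<lambda>g. restrict (\<phi> g) (tree_ball n)"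
  obtain T where T: "T \<subseteq> carrier G" "finite T" "?f ` carrier G = ?f ` T"
    using finite_subset_image[OF finite_ball_actions[of n] subset_refl] by blast
  show ?thesis
  proof (rule that[OF T(2,1)])
    fix g assume g: "g \<in> carrier G"
    then have "?f g \<in> ?f ` T" using T(3) by blast
    then obtain t where t: "t \<in> T" "?f g = ?f t" by blast
    then have "t \<in> carrier G" using T by auto
    then have "g \<otimes> inv t \<in> ball_stabilizer n" "g = g \<otimes> inv t \<otimes> t"
      using same_ball_action_imp_stabilizer[OF g _ t(2)] g by (auto simp: m_assoc)
    then show "\<exists>k\<in>ball_stabilizer n. \<exists>t\<in>T. g = k \<otimes> t" using t by blast
  qed
qed

text \<open>
  Infinitely many elements of \<open>H\<close> act in the same way on the finite ball, and their quotients fix it.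
\<close>

lemma infinite_Int_ball_stabilizer:
  assumes H: "subgroup H G" and inf: "infinite H"
  shows "infinite (H \<inter> ball_stabilizer n)"
proof
  assume fin: "finite (H \<inter> ball_stabilizer n)"
  interpret H: subgroup H G by (rule H)
  let ?f = "\<lambda>g. restrict (\<phi> g) (tree_ball n)"
  have "finite (?f ` H)"
    by (rule finite_subset[OF _ finite_ball_actions[of n]]) (use H.subset in auto)
  then obtain a where a: "a \<in> H" "infinite {g \<in> H. ?f g = ?f a}"
    using pigeonhole_infinite[OF inf] by blast
  have "inj_on (\<lambda>g. g \<otimes> inv a) {g \<in> H. ?f g = ?f a}"
    using a(1) by (intro inj_onI) auto
  moreover have "(\<lambda>g. g \<otimes> inv a) ` {g \<in> H. ?f g = ?f a} \<subseteq> H \<inter> ball_stabilizer n"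
    using a(1) same_ball_action_imp_stabilizer by auto
  ultimately have "finite {g \<in> H. ?f g = ?f a}" using fin by (rule inj_on_finite)
  then show False using a(2) by simp
qed

lemma trivial_if_fixes_level_subtrees:
  assumes faithful: "inj_on \<phi> (carrier G)" and g: "g \<in> ball_stabilizer n"
    and fixes_subtrees: "\<And>w. w \<in> tree_level V E r n \<Longrightarrow> g \<in> subtree_stabilizer G V E r \<phi> w"
  shows "g = \<one>"
proof -
  have gG: "g \<in> carrier G" using g by (simp add: ball_stabilizer_def)
  have "\<phi> g x = x" if x: "x \<in> V" for x
  proof (cases "graph_dist V E r x \<le> n")
    case True
    then show ?thesis using g x by (simp add: ball_stabilizer_def tree_ball_def)
  next
    case False
    obtain p where p: "walk_betw V E r p x" "length p = Suc (graph_dist V E r x)"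
      using geodesic_obtain[OF root_in_V x] by blast
    have w: "p ! n \<in> tree_level V E r n"
      using graph_dist_on_geodesic[OF p, of n] False by (simp add: tree_level_def)
    have "p ! n \<in> set p" using p False by simp
    then have "x \<in> descendants V E r (p ! n)"
      using p x unfolding descendants_def geodesic_betw_def by blast
    then show ?thesis using fixes_subtrees[OF w] by (simp add: subtree_stabilizer_def)
  qed
  then have "\<phi> g x = \<phi> \<one> x" for x
  proof (cases "x \<in> V")
    case False
    then show ?thesis using bij_prop0[OF gG] bij_prop0[OF one_closed] by (auto simp: Bij_def extensional_def)
  qed (simp add: act_one)
  then have "\<phi> g = \<phi> \<one>" by blast
  then show ?thesis using faithful gG by (auto dest: inj_onD)
qed

text \<open>
  Otherwise the subtree stabilizers of all vertices of a level would be infinite. Their intersections with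
  the ball stabilizer are then infinite normal subgroups of it, so adding one vertex after another keeps
  the common intersection infinite; but for the whole level it is trivial.
\<close>

lemma finite_subtree_stabilizer:
  assumes hyp: "hyperbolic_group G" and nonel: "\<not> elementary_group G"
    and faithful: "inj_on \<phi> (carrier G)" and trans: "spherically_transitive G V E r \<phi>"
    and v: "v \<in> V"
  shows "finite (subtree_stabilizer G V E r \<phi> v)"
proof (rule ccontr)
  assume inf: "infinite (subtree_stabilizer G V E r \<phi> v)"
  obtain dst \<delta> where "hyperbolic_metric_group G dst \<delta>" using hyperbolic_group_imp_metric[OF hyp] .
  then interpret hyp: hyperbolic_metric_group G dst \<delta> .
  define n where "n = graph_dist V E r v"
  define L where "L = tree_level V E r n"
  define K where "K = ball_stabilizer n"
  define N where "N = (\<lambda>w. subtree_stabilizer G V E r \<phi> w \<inter> K)"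
  have vL: "v \<in> L" using v by (simp add: L_def tree_level_def n_def)
  have L_ball: "L \<subseteq> tree_ball n" by (auto simp: L_def tree_level_def tree_ball_def)
  then have finL: "finite L" using finite_tree_ball by (rule finite_subset)
  have K: "subgroup K G" unfolding K_def by (rule subgroup_ball_stabilizer)
  have N_sub: "subgroup (N w) G" for w
    unfolding N_def by (intro subgroups_Inter_pair subgroup_subtree_stabilizer K)
  have N_conj: "k \<otimes> x \<otimes> inv k \<in> N w" if "w \<in> L" "k \<in> K" "x \<in> N w" for w k x
  proof -
    have w: "w \<in> V" "\<phi> k w = w" using that L_ball by (auto simp: tree_ball_def K_def ball_stabilizer_def)
    have k: "k \<in> carrier G" using that by (simp add: K_def ball_stabilizer_def)
    show ?thesis
      using subtree_stabilizer_conj[OF k w(1), of x] ball_stabilizer_conj[OF k, of x n] that w(2)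
      by (auto simp: N_def K_def)
  qed
  have N_inf: "infinite (N w)" if w: "w \<in> L" for w
  proof -
    obtain g where g: "g \<in> carrier G" "\<phi> g v = w"
      using trans vL w unfolding spherically_transitive_def L_def by blast
    have sub: "(\<lambda>h. g \<otimes> h \<otimes> inv g) ` subtree_stabilizer G V E r \<phi> v \<subseteq> subtree_stabilizer G V E r \<phi> w"
      using subtree_stabilizer_conj[OF g(1) v] g(2) by auto
    have inj: "inj_on (\<lambda>h. g \<otimes> h \<otimes> inv g) (subtree_stabilizer G V E r \<phi> v)"
      using g(1) by (intro inj_onI) (auto simp: subtree_stabilizer_def)
    have "infinite (subtree_stabilizer G V E r \<phi> w)" using inf inj_on_finite[OF inj sub] by blast
    then show ?thesis
      unfolding N_def K_def by (intro infinite_Int_ball_stabilizer subgroup_subtree_stabilizer)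
  qed
  obtain T where T: "finite T" "T \<subseteq> carrier G" "\<And>g. g \<in> carrier G \<Longrightarrow> \<exists>k\<in>K. \<exists>t\<in>T. g = k \<otimes> t"
    using ball_stabilizer_cover[of n] unfolding K_def by blast
  have "infinite (\<Inter>w\<in>W. N w)" if "finite W" "W \<noteq> {}" "W \<subseteq> L" for W
    using that
  proof (induction W rule: finite_ne_induct)
    case (singleton w)
    then show ?case using N_inf by simp
  next
    case (insert w W)
    have "subgroup (\<Inter>w\<in>W. N w) G"
      using insert.hyps N_sub by (intro subgroups_Inter) auto
    moreover have "(\<Inter>w\<in>W. N w) \<subseteq> K" using insert.hyps by (auto simp: N_def)
    moreover have "k \<otimes> x \<otimes> inv k \<in> (\<Inter>w\<in>W. N w)" if "k \<in> K" "x \<in> (\<Inter>w\<in>W. N w)" for k x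
      using that N_conj insert.prems by blast
    moreover have "infinite (N w)" "N w \<subseteq> K" using N_inf insert.prems by (auto simp: N_def)
    ultimately have "infinite (N w \<inter> (\<Inter>w\<in>W. N w))"
      using insert.IH insert.prems N_sub N_conj
      by (intro hyp.infinite_Int_normal[OF nonel K T]) auto
    then show ?case by simp
  qed
  from this[OF finL _ subset_refl] have "infinite (\<Inter>w\<in>L. N w)" using vL by blast
  moreover have "(\<Inter>w\<in>L. N w) \<subseteq> {\<one>}"
  proof
    fix g assume "g \<in> (\<Inter>w\<in>L. N w)"
    then have g: "\<And>w. w \<in> L \<Longrightarrow> g \<in> N w" by blast
    have "g = \<one>"
    proof (rule trivial_if_fixes_level_subtrees[OF faithful])
      show "g \<in> ball_stabilizer n" using g[OF vL] by (simp add: N_def K_def)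
      show "g \<in> subtree_stabilizer G V E r \<phi> w" if "w \<in> tree_level V E r n" for w
        using g[of w] that by (simp add: N_def L_def)
    qed
    then show "g \<in> {\<one>}" by simp
  qed
  ultimately show False by (meson finite.emptyI finite_insert finite_subset)
qed

text \<open>
  The stabilizer of the ball up to the level of \<open>v\<close> fixes \<open>v\<close>, so it normalizes the subtree stabilizer of \<open>v\<close>.
\<close>

lemma subtree_stabilizer_subset_fc_center:
  assumes fin: "finite (subtree_stabilizer G V E r \<phi> v)" and v: "v \<in> V"
  shows "subtree_stabilizer G V E r \<phi> v \<subseteq> fc_center G"
proof -
  define n where "n = graph_dist V E r v"
  obtain T where T: "finite T" "T \<subseteq> carrier G"
    "\<And>g. g \<in> carrier G \<Longrightarrow> \<exists>k\<in>ball_stabilizer n. \<exists>t\<in>T. g = k \<otimes> t"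
    using ball_stabilizer_cover[of n] by blast
  show ?thesis
  proof (rule finite_normalized_subset_fc_center[OF subgroup_ball_stabilizer T fin])
    show "subtree_stabilizer G V E r \<phi> v \<subseteq> carrier G" by (auto simp: subtree_stabilizer_def)
    fix k x assume k: "k \<in> ball_stabilizer n" and x: "x \<in> subtree_stabilizer G V E r \<phi> v"
    have "v \<in> tree_ball n" using v by (simp add: tree_ball_def n_def)
    then have "k \<in> carrier G" "\<phi> k v = v" using k by (auto simp: ball_stabilizer_def)
    then show "k \<otimes> x \<otimes> inv k \<in> subtree_stabilizer G V E r \<phi> v"
      using subtree_stabilizer_conj[OF _ v x, of k] by simp
  qed
qed

end

theorem proposition6p2:
  fixes G :: "('g, 'b) monoid_scheme"
    and V :: "'v set" and E :: "('v \<times> 'v) set" and r :: 'v and d :: "nat \<Rightarrow> nat"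
    and \<phi> :: "'g \<Rightarrow> 'v \<Rightarrow> 'v"
  assumes "hyperbolic_group G"
    and "\<not> elementary_group G"
    and "rooted_tree_action V E r d G \<phi>"
    and "faithful_action G V \<phi>"
    and "spherically_transitive G V E r \<phi>"
  shows "finite (\<Union>v\<in>V. subtree_stabilizer G V E r \<phi> v)"
proof -
  interpret rooted_tree_action V E r d G \<phi> by fact
  have faithful: "inj_on \<phi> (carrier G)" using assms(4) by (rule faithful_action.faithful)
  obtain dst \<delta> where hyp: "hyperbolic_metric_group G dst \<delta>"
    using hyperbolic_group_imp_metric[OF assms(1)] .
  have "(\<Union>v\<in>V. subtree_stabilizer G V E r \<phi> v) \<subseteq> fc_center G"
    using finite_subtree_stabilizer[OF assms(1,2) faithful assms(5)]
      subtree_stabilizer_subset_fc_center by blast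
  moreover have "finite (fc_center G)"
    using hyp assms(2) by (rule hyperbolic_metric_group.finite_fc_center)
  ultimately show ?thesis by (rule finite_subset)
qed

end
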